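(* Let $p\in\mathbb{C}[X_1,\dots,X_d,T]$. Then $N_{\mathcal{L}(\mathcal{D}(\mathbb{R}),\mathcal{E}'(\mathbb{R}^d))}(p)=\{0\}$ if and only if $p\neq 0$.
   Context: $\mathcal{E}'(\mathbb{R}^d)$ is the space of compactly supported distributions on $\mathbb{R}^d$ (with its usual topology). $\mathcal{L}(\mathcal{D}(\mathbb{R}),\mathcal{E}'(\mathbb{R}^d))$ is the space of continuous linear maps $\mathcal{D}(\mathbb{R})\to\mathcal{E}'(\mathbb{R}^d)$; each such $u$ is regarded as the distribution $U\in\mathcal{D}'(\mathbb{R}^{d+1})$ with $\langle U,\varphi\otimes\psi\rangle=\langle u(\varphi),\psi\rangle$ for $\varphi\in\mathcal{D}(\mathbb{R})$, $\psi\in\mathcal{D}(\mathbb{R}^d)$. Coordinates on $\mathbb{R}^{d+1}$ are $(\mathbf{x},t)$; $D_p=p\left(\frac{\partial}{\partial x_1},\dots,\frac{\partial}{\partial x_d},\frac{\partial}{\partial t}\right)$; for a subspace $S\subset\mathcal{D}'(\mathbb{R}^{d+1})$, $N_S(p)=\{u\in S: D_pu=0,\ u|_{t<0}=0\}$, where $u|_{t<0}$ is the restriction to $\{t<0\}$. *)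

theory Defs
  imports "HOL-Analysis.Analysis" "HOL-Library.Poly_Mapping"
begin

definition pd :: "'a::real_normed_vector \<Rightarrow> ('a \<Rightarrow> complex) \<Rightarrow> 'a \<Rightarrow> complex" where
  "pd v f x = vector_derivative (\<lambda>h::real. f (x + h *\<^sub>R v)) (at 0)"

definition iterpd :: "'a::real_normed_vector list \<Rightarrow> ('a \<Rightarrow> complex) \<Rightarrow> 'a \<Rightarrow> complex" where
  "iterpd vs f = foldr pd vs f"

definition smooth :: "('a::euclidean_space \<Rightarrow> complex) \<Rightarrow> bool" where
  "smooth f \<longleftrightarrow> (\<forall>vs. set vs \<subseteq> Basis \<longrightarrow>
      continuous_on UNIV (iterpd vs f) \<and>
      (\<forall>v\<in>Basis. \<forall>x. (\<lambda>h::real. iterpd vs f (x + h *\<^sub>R v)) differentiable (at 0)))"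

definition tsupp :: "('a::euclidean_space \<Rightarrow> complex) \<Rightarrow> 'a set" where
  "tsupp f = closure {x. f x \<noteq> 0}"

definition test :: "('a::euclidean_space \<Rightarrow> complex) \<Rightarrow> bool" where
  "test f \<longleftrightarrow> smooth f \<and> compact (tsupp f)"

definition sn :: "nat \<Rightarrow> 'a::euclidean_space set \<Rightarrow> ('a \<Rightarrow> complex) \<Rightarrow> real" where
  "sn N K f = (\<Sum>vs\<in>{vs. set vs \<subseteq> Basis \<and> length vs \<le> N}.
                 Sup ((\<lambda>x. norm (iterpd vs f x)) ` K))"

text \<open>Distributions in D'; represented canonically (value 0 off the test functions).\<close>
definition distribution :: "(('a::euclidean_space \<Rightarrow> complex) \<Rightarrow> complex) \<Rightarrow> bool" where
  "distribution U \<longleftrightarrow>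
     (\<forall>f g a b. test f \<longrightarrow> test g \<longrightarrow> U (\<lambda>x. a * f x + b * g x) = a * U f + b * U g) \<and>
     (\<forall>f. \<not> test f \<longrightarrow> U f = 0) \<and>
     (\<forall>K. compact K \<longrightarrow> (\<exists>C N. \<forall>f. test f \<and> tsupp f \<subseteq> K \<longrightarrow> norm (U f) \<le> C * sn N K f))"

text \<open>Compactly supported distributions E' = continuous linear functionals on E = C-infinity,
  represented canonically (value 0 off the smooth functions).\<close>
definition edist :: "(('a::euclidean_space \<Rightarrow> complex) \<Rightarrow> complex) \<Rightarrow> bool" where
  "edist v \<longleftrightarrow>
     (\<forall>f g a b. smooth f \<longrightarrow> smooth g \<longrightarrow> v (\<lambda>x. a * f x + b * g x) = a * v f + b * v g) \<and>
     (\<forall>f. \<not> smooth f \<longrightarrow> v f = 0) \<and>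
     (\<exists>K C N. compact K \<and> (\<forall>f. smooth f \<longrightarrow> norm (v f) \<le> C * sn N K f))"

definition ebounded :: "('a::euclidean_space \<Rightarrow> complex) set \<Rightarrow> bool" where
  "ebounded B \<longleftrightarrow> (\<forall>f\<in>B. smooth f) \<and> (\<forall>K N. compact K \<longrightarrow> bdd_above (sn N K ` B))"

text \<open>Continuous linear maps D(R) to E'(R^d), E' carrying its usual (strong dual) topology.
  Continuity on the LF-space D(R) means continuity on each D_K; the strong topology is given
  by the seminorms v mapsto sup over psi in B of |v psi|, B bounded in E.\<close>
definition Lmap :: "((real \<Rightarrow> complex) \<Rightarrow> ('a::euclidean_space \<Rightarrow> complex) \<Rightarrow> complex) \<Rightarrow> bool" where
  "Lmap u \<longleftrightarrow>
     (\<forall>f. test f \<longrightarrow> edist (u f)) \<and>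
     (\<forall>f g a b. test f \<longrightarrow> test g \<longrightarrow>
         u (\<lambda>x. a * f x + b * g x) = (\<lambda>\<psi>. a * u f \<psi> + b * u g \<psi>)) \<and>
     (\<forall>K B. compact K \<longrightarrow> ebounded B \<longrightarrow>
         (\<exists>C N. \<forall>f. test f \<and> tsupp f \<subseteq> K \<longrightarrow> (\<forall>\<psi>\<in>B. norm (u f \<psi>) \<le> C * sn N K f)))"

text \<open>L(D(R), E'(R^d)) regarded as a subspace of D'(R^(d+1)), coordinates (x,t).\<close>
definition LDE :: "(((real^'d) \<times> real \<Rightarrow> complex) \<Rightarrow> complex) set" where
  "LDE = {U. distribution U \<and>
            (\<exists>u. Lmap u \<and> (\<forall>\<phi> \<psi>. test \<phi> \<longrightarrow> test \<psi> \<longrightarrow>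
                 U (\<lambda>(x, t). \<phi> t * \<psi> x) = u \<phi> \<psi>))}"

text \<open>A polynomial in C[X_1..X_d,T]: variable Some i is X_i, variable None is T.
  Monomials are finitely supported exponent maps.\<close>

definition Dmono :: "('d::finite option \<Rightarrow>\<^sub>0 nat) \<Rightarrow> ((real^'d) \<times> real \<Rightarrow> complex)
                     \<Rightarrow> (real^'d) \<times> real \<Rightarrow> complex" where
  "Dmono m f = (pd ((0::real^'d), (1::real)) ^^ Poly_Mapping.lookup m None)
      (foldr (\<lambda>i g. (pd (axis i (1::real), (0::real)) ^^ Poly_Mapping.lookup m (Some i)) g)
             (SOME l. distinct l \<and> set l = UNIV) f)"

definition dop_t :: "(('d::finite option \<Rightarrow>\<^sub>0 nat) \<Rightarrow>\<^sub>0 complex) \<Rightarrow> ((real^'d) \<times> real \<Rightarrow> complex)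
                     \<Rightarrow> (real^'d) \<times> real \<Rightarrow> complex" where
  "dop_t p f = (\<lambda>z. \<Sum>m\<in>Poly_Mapping.keys p. Poly_Mapping.lookup p m * (-1) ^ (\<Sum>v\<in>Poly_Mapping.keys m. Poly_Mapping.lookup m v) * Dmono m f z)"

definition Dp :: "(('d::finite option \<Rightarrow>\<^sub>0 nat) \<Rightarrow>\<^sub>0 complex) \<Rightarrow> (((real^'d) \<times> real \<Rightarrow> complex) \<Rightarrow> complex)
                  \<Rightarrow> ((real^'d) \<times> real \<Rightarrow> complex) \<Rightarrow> complex" where
  "Dp p U f = (if test f then U (dop_t p f) else 0)"

definition vanishes_neg :: "(((real^'d) \<times> real \<Rightarrow> complex) \<Rightarrow> complex) \<Rightarrow> bool" where
  "vanishes_neg U \<longleftrightarrow> (\<forall>f. test f \<and> tsupp f \<subseteq> {z. snd z < 0} \<longrightarrow> U f = 0)"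

definition NS :: "(((real^'d) \<times> real \<Rightarrow> complex) \<Rightarrow> complex) set
                  \<Rightarrow> (('d::finite option \<Rightarrow>\<^sub>0 nat) \<Rightarrow>\<^sub>0 complex)
                  \<Rightarrow> (((real^'d) \<times> real \<Rightarrow> complex) \<Rightarrow> complex) set" where
  "NS S p = {U \<in> S. Dp p U = (\<lambda>_. 0) \<and> vanishes_neg U}"

end

theory Submission
  imports Defs "HOL-Computational_Algebra.Fundamental_Theorem_Algebra"
begin

text \<open>For \<open>p = 0\<close> the point mass at \<open>(0, 1)\<close> is a non-trivial element.  For \<open>p \<noteq> 0\<close>, instead of taking the
  Fourier transform in \<open>x\<close>, expand it at the origin: \<open>D\<^sub>p U = 0\<close> becomes an equation between formal power
  series in \<open>\<xi>\<close> whose coefficients are the moments \<open>M\<^sub>\<alpha>(\<phi>) = u(\<phi>)(x\<^sup>\<alpha> / \<alpha>!)\<close>, distributions on the line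
  that vanish for \<open>t < 0\<close>.  Choose an additive weight on multi-indices that separates the \<open>x\<close>-exponents
  occurring in \<open>p\<close> and let \<open>\<beta>\<^sub>0\<close> be the lightest of them, with coefficient \<open>q(T) \<noteq> 0\<close>.  By induction on the
  weight of \<open>\<alpha>\<close>, the coefficient of \<open>\<xi>\<close> to the power \<open>\<alpha> + \<beta>\<^sub>0\<close> reduces to \<open>q(d/dt) M\<^sub>\<alpha> = 0\<close>, and an ordinary differential
  operator with constant coefficients is injective on distributions vanishing for \<open>t < 0\<close>; so all
  moments vanish.  Polynomials being dense in the smooth functions, \<open>u(\<phi>) = 0\<close>, and since polynomials
  in \<open>(x, t)\<close> are sums of tensor products, \<open>U = 0\<close>.\<close>

section \<open>Calculus of smooth functions\<close>

text \<open>Compact support in \<open>x\<close> is essential: for \<open>p = X\<^sub>1\<close>, a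
  distribution that is constant in \<open>x\<close> and supported in \<open>t \<ge> 0\<close> would
  be a null solution. Compactness lets \<open>u(\<phi>)\<close> act on monomials and makes its
  Fourier-Laplace transform entire, hence determined by its Taylor coefficients at one point. The
  obstacle at that point is that the leading coefficient of \<open>p\<close> in \<open>T\<close>, or
  all of \<open>p\<close>, may vanish at \<xi> = 0, so the zeroth coefficient of the equation need
  not determine the zeroth moment. Shifting by the lightest exponent repairs this: additivity gives
  \<open>\<alpha> + \<beta>\<^sub>0 - \<beta>\<close> a weight below that of \<alpha> whenever
  \<beta> is heavier than \<open>\<beta>\<^sub>0\<close>, so the other exponents only contribute
  moments already known to vanish. Separation of the exponents ensures that one of them alone is
  lightest, which leaves an equation for a single moment and not a coupled system. Injectivity of
  \<open>q(d/dt)\<close> enters in dual form: every test function is \<open>q(d/dt) g\<close> plus a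
  test function supported in \<open>t < 0\<close>.\<close>

definition has_pd :: "('a::real_normed_vector \<Rightarrow> complex) \<Rightarrow> 'a \<Rightarrow> ('a \<Rightarrow> complex) \<Rightarrow> bool" where
  "has_pd f v g \<longleftrightarrow> (\<forall>x. ((\<lambda>h::real. f (x + h *\<^sub>R v)) has_vector_derivative g x) (at 0))"

text \<open>\<open>pd\<close> has an unspecified value where no derivative exists, so the calculus
  rules are proved for the relation \<open>has_pd\<close>, which carries existence, and transferred
  to \<open>pd\<close> from there.\<close>

lemma has_pd_imp_pd: "has_pd f v g \<Longrightarrow> pd v f = g"
  unfolding has_pd_def by (auto simp: pd_def fun_eq_iff intro!: vector_derivative_at)

lemma has_pd_add:
  assumes "has_pd f v f'" "has_pd g v g'"
  shows "has_pd (\<lambda>x. f x + g x) v (\<lambda>x. f' x + g' x)"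
  using assms unfolding has_pd_def by (auto intro!: has_vector_derivative_add)

lemma has_pd_mult:
  assumes "has_pd f v f'" "has_pd g v g'"
  shows "has_pd (\<lambda>x. f x * g x) v (\<lambda>x. f x * g' x + f' x * g x)"
  unfolding has_pd_def
proof
  fix x
  have "((\<lambda>h. f (x + h *\<^sub>R v) * g (x + h *\<^sub>R v)) has_vector_derivative
     f (x + 0 *\<^sub>R v) * g' x + f' x * g (x + 0 *\<^sub>R v)) (at 0)"
    using assms unfolding has_pd_def by (intro has_vector_derivative_mult) auto
  then show "((\<lambda>h. f (x + h *\<^sub>R v) * g (x + h *\<^sub>R v)) has_vector_derivative
     f x * g' x + f' x * g x) (at 0)" by simp
qed

lemma has_pd_const: "has_pd (\<lambda>_. c) v (\<lambda>_. 0)"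
  unfolding has_pd_def by auto

text \<open>\<open>has_pd\<close> differentiates at \<open>h = 0\<close> only; moving the base point
  along the line makes the one-variable theorems available at every parameter
  \<open>s\<close>.\<close>

lemma has_pd_along:
  assumes "has_pd f v g"
  shows "((\<lambda>h. f (x + h *\<^sub>R v)) has_vector_derivative g (x + s *\<^sub>R v)) (at s within T)"
proof -
  have "((\<lambda>h. f ((x + s *\<^sub>R v) + h *\<^sub>R v)) has_vector_derivative g (x + s *\<^sub>R v)) (at 0)"
    using assms unfolding has_pd_def by blast
  then have "((\<lambda>h. f ((x + s *\<^sub>R v) + h *\<^sub>R v)) \<circ> (\<lambda>h. h - s) has_vector_derivative 1 *\<^sub>R g (x + s *\<^sub>R v)) (at s)"
    by (intro vector_diff_chain_at) (auto intro!: derivative_eq_intros)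
  moreover have "(\<lambda>h. f ((x + s *\<^sub>R v) + h *\<^sub>R v)) \<circ> (\<lambda>h. h - s) = (\<lambda>h. f (x + h *\<^sub>R v))"
    by (auto simp: fun_eq_iff algebra_simps)
  ultimately show ?thesis by (simp add: has_vector_derivative_at_within)
qed

lemma has_pd_real_iff:
  "has_pd f (1::real) g \<longleftrightarrow> (\<forall>t. (f has_vector_derivative g t) (at t))"
proof
  assume "has_pd f 1 g"
  from has_pd_along[OF this, of 0] show "\<forall>t. (f has_vector_derivative g t) (at t)" by simp
next
  assume *: "\<forall>t. (f has_vector_derivative g t) (at t)"
  show "has_pd f 1 g" unfolding has_pd_def
  proof
    fix x :: real
    have "(f \<circ> (\<lambda>h. x + h *\<^sub>R 1) has_vector_derivative 1 *\<^sub>R g x) (at 0)"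
      using * by (intro vector_diff_chain_at) (auto intro!: derivative_eq_intros)
    then show "((\<lambda>h. f (x + h *\<^sub>R 1)) has_vector_derivative g x) (at 0)" by (simp add: o_def)
  qed
qed

text \<open>Smoothness as a greatest fixed point: a class of continuous functions containing a
  partial derivative of each member in each basis direction is stable under \<open>iterpd\<close>.
  No formula for higher derivatives is required.\<close>

lemma smooth_coinduct:
  assumes "f \<in> S" and c: "\<And>f. f \<in> S \<Longrightarrow> continuous_on UNIV f"
    and d: "\<And>f v. f \<in> S \<Longrightarrow> v \<in> Basis \<Longrightarrow> \<exists>g\<in>S. has_pd f v g"
  shows "smooth f"
proof -
  have "iterpd vs f \<in> S" if "set vs \<subseteq> Basis" for vs
    using that
  proof (induction vs)
    case Nil then show ?case using assms(1) by (simp add: iterpd_def)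
  next
    case (Cons v vs)
    then obtain g where "g \<in> S" "has_pd (iterpd vs f) v g" using d by (metis insert_subset list.simps(15))
    then show ?case using has_pd_imp_pd by (auto simp: iterpd_def)
  qed
  then show ?thesis unfolding smooth_def
    using c d by (auto simp: has_pd_def differentiableI_vector) (meson differentiableI_vector)
qed

lemma iterpd_Nil [simp]: "iterpd [] f = f"
  and iterpd_Cons: "iterpd (v # vs) f = pd v (iterpd vs f)"
  and iterpd_snoc: "iterpd (vs @ [v]) f = iterpd vs (pd v f)"
  by (auto simp: iterpd_def)

lemma smooth_continuous: "smooth f \<Longrightarrow> continuous_on S f"
  unfolding smooth_def by (metis continuous_on_subset iterpd_Nil empty_set empty_subsetI top_greatest)

lemma smooth_has_pd: "smooth f \<Longrightarrow> v \<in> Basis \<Longrightarrow> has_pd f v (pd v f)"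
  unfolding smooth_def has_pd_def pd_def
  by (metis vector_derivative_works iterpd_Nil empty_set empty_subsetI)

lemma smooth_pd: 
  assumes "smooth f" "v \<in> Basis" shows "smooth (pd v f)"
  unfolding smooth_def iterpd_snoc[symmetric]
  using assms unfolding smooth_def by (metis set_append Un_subset_iff empty_set empty_subsetI insert_subset list.simps(15))

lemma smooth_iterpd: "smooth f \<Longrightarrow> set vs \<subseteq> Basis \<Longrightarrow> smooth (iterpd vs f)"
  by (induction vs) (auto simp: iterpd_Cons smooth_pd)

lemma smooth_funpow_pd: "smooth f \<Longrightarrow> v \<in> Basis \<Longrightarrow> smooth ((pd v ^^ n) f)"
  by (induction n) (auto simp: smooth_pd)

text \<open>The Leibniz rule turns one product into a sum of two, so the set of products is not
  stable under derivatives, but the ring generated by the smooth functions is.\<close>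

inductive_set smooth_ring :: "('a::euclidean_space \<Rightarrow> complex) set" where
  base: "smooth f \<Longrightarrow> f \<in> smooth_ring"
| add: "f \<in> smooth_ring \<Longrightarrow> g \<in> smooth_ring \<Longrightarrow> (\<lambda>x. f x + g x) \<in> smooth_ring"
| mult: "f \<in> smooth_ring \<Longrightarrow> g \<in> smooth_ring \<Longrightarrow> (\<lambda>x. f x * g x) \<in> smooth_ring"

lemma smooth_ring_step:
  assumes "f \<in> smooth_ring"
  shows "continuous_on UNIV f \<and> (\<forall>v\<in>Basis. \<exists>g\<in>smooth_ring. has_pd f v g)"
  using assms
proof induction
  case (base f)
  then show ?case using smooth_continuous smooth_has_pd smooth_pd smooth_ring.base by blast
next
  case (add f g)
  have "\<exists>k\<in>smooth_ring. has_pd (\<lambda>x. f x + g x) v k" if "v \<in> Basis" for v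
  proof -
    from add that obtain f' g' where "f' \<in> smooth_ring" "has_pd f v f'" "g' \<in> smooth_ring" "has_pd g v g'"
      by blast
    then show ?thesis by (blast intro: smooth_ring.add has_pd_add)
  qed
  with add show ?case by (simp add: continuous_on_add)
next
  case (mult f g)
  have "\<exists>k\<in>smooth_ring. has_pd (\<lambda>x. f x * g x) v k" if "v \<in> Basis" for v
  proof -
    from mult that obtain f' g' where "f' \<in> smooth_ring" "has_pd f v f'" "g' \<in> smooth_ring" "has_pd g v g'"
      by blast
    moreover from this have "(\<lambda>x. f x * g' x + f' x * g x) \<in> smooth_ring"
      using mult by (intro smooth_ring.add smooth_ring.mult)
    ultimately show ?thesis by (blast intro: has_pd_mult)
  qed
  with mult show ?case by (simp add: continuous_on_mult)
qed

lemma smooth_ring_smooth: "f \<in> smooth_ring \<Longrightarrow> smooth f"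
  by (erule smooth_coinduct) (use smooth_ring_step in auto)

lemma smooth_add: "smooth f \<Longrightarrow> smooth g \<Longrightarrow> smooth (\<lambda>x. f x + g x)"
  and smooth_mult: "smooth f \<Longrightarrow> smooth g \<Longrightarrow> smooth (\<lambda>x. f x * g x)"
  by (auto intro!: smooth_ring_smooth intro: smooth_ring.intros)

lemma smooth_const: "smooth (\<lambda>_. c)"
  by (rule smooth_coinduct[of _ "range (\<lambda>c _. c)"]) (auto simp: intro: has_pd_const)

lemma smooth_cmult: "smooth f \<Longrightarrow> smooth (\<lambda>x. c * f x)"
  by (intro smooth_mult smooth_const)

lemma smooth_diff: "smooth f \<Longrightarrow> smooth g \<Longrightarrow> smooth (\<lambda>x. f x - g x)"
  using smooth_add[of f "\<lambda>x. (-1) * g x"] smooth_cmult[of g "-1"] by simp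

lemma smooth_prod: "(\<And>i. i \<in> I \<Longrightarrow> smooth (f i)) \<Longrightarrow> smooth (\<lambda>x. \<Prod>i\<in>I. f i x)"
  by (induction I rule: infinite_finite_induct) (auto simp: smooth_const smooth_mult)

lemma pd_mult: "smooth f \<Longrightarrow> smooth g \<Longrightarrow> v \<in> Basis \<Longrightarrow>
    pd v (\<lambda>x. f x * g x) = (\<lambda>x. f x * pd v g x + pd v f x * g x)"
  by (intro has_pd_imp_pd has_pd_mult smooth_has_pd)

lemma pd_lincomb: 
  assumes "smooth f" "smooth g" "v \<in> Basis"
  shows "pd v (\<lambda>x. a * f x + b * g x) = (\<lambda>x. a * pd v f x + b * pd v g x)"
proof -
  have "has_pd (\<lambda>x. a * f x) v (\<lambda>x. a * pd v f x + 0 * f x)" if "smooth f" for a and f :: "'a \<Rightarrow> complex"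
    using that assms by (intro has_pd_mult has_pd_const smooth_has_pd)
  then show ?thesis using assms by (intro has_pd_imp_pd has_pd_add) auto
qed

lemma iterpd_lincomb: 
  assumes "smooth f" "smooth g" "set vs \<subseteq> Basis"
  shows "iterpd vs (\<lambda>x. a * f x + b * g x) = (\<lambda>x. a * iterpd vs f x + b * iterpd vs g x)"
  using assms by (induction vs) (auto simp: iterpd_Cons pd_lincomb smooth_iterpd)

lemma iterpd_add: "smooth f \<Longrightarrow> smooth g \<Longrightarrow> set vs \<subseteq> Basis \<Longrightarrow>
    iterpd vs (\<lambda>x. f x + g x) = (\<lambda>x. iterpd vs f x + iterpd vs g x)"
  using iterpd_lincomb[of f g vs 1 1] by simp

lemma iterpd_diff: "smooth f \<Longrightarrow> smooth g \<Longrightarrow> set vs \<subseteq> Basis \<Longrightarrow>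
    iterpd vs (\<lambda>x. f x - g x) = (\<lambda>x. iterpd vs f x - iterpd vs g x)"
  using iterpd_lincomb[of f g vs 1 "-1"] by simp

lemma has_pd_comp_linear:
  assumes "linear L" "has_pd f (L v) g"
  shows "has_pd (\<lambda>x. f (L x)) v (\<lambda>x. g (L x))"
  using assms(2) unfolding has_pd_def by (simp add: linear_add[OF assms(1)] linear_scale[OF assms(1)])

text \<open>The condition on \<open>L\<close> keeps every derivative of the form
  \<open>g (L x)\<close>, without linear combinations; projections and coordinate functions satisfy
  it.\<close>

lemma smooth_comp_linear:
  fixes L :: "'a::euclidean_space \<Rightarrow> 'b::euclidean_space"
  assumes "linear L" "\<And>v. v \<in> Basis \<Longrightarrow> L v \<in> Basis \<or> L v = 0" "smooth f"
  shows "smooth (\<lambda>x. f (L x))"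
proof (rule smooth_coinduct[of _ "{(\<lambda>x. f (L x)) |f. smooth f}"])
  show "(\<lambda>x. f (L x)) \<in> {(\<lambda>x. f (L x)) |f. smooth f}" using assms by auto
next
  fix h :: "'a \<Rightarrow> complex" assume "h \<in> {(\<lambda>x. f (L x)) |f. smooth f}"
  then obtain f where f: "smooth f" "h = (\<lambda>x. f (L x))" by auto
  have "continuous_on UNIV L" using assms(1) by (simp add: linear_conv_bounded_linear linear_continuous_on)
  then show "continuous_on UNIV h" unfolding f(2)
    by (rule continuous_on_compose2[OF smooth_continuous[OF f(1), of UNIV]]) auto
next
  fix h :: "'a \<Rightarrow> complex" and v :: 'a
  assume "h \<in> {(\<lambda>x. f (L x)) |f. smooth f}" and v: "v \<in> Basis"
  then obtain f where f: "smooth f" "h = (\<lambda>x. f (L x))" by auto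
  show "\<exists>g\<in>{(\<lambda>x. f (L x)) |f. smooth f}. has_pd h v g"
  proof (cases "L v = 0")
    case True
    have "has_pd h v (\<lambda>x. 0)" unfolding f(2)
      by (rule has_pd_comp_linear[OF assms(1), where g = "\<lambda>_. 0"]) (simp add: True has_pd_def)
    then show ?thesis using smooth_const[of 0] by (intro bexI[of _ "\<lambda>_. 0"]) auto
  next
    case False
    then have "L v \<in> Basis" using assms(2) v by auto
    then show ?thesis using has_pd_comp_linear[OF assms(1) smooth_has_pd[OF f(1)], of v] smooth_pd[OF f(1)] f
      by (intro bexI[of _ "\<lambda>x. pd (L v) f (L x)"]) auto
  qed
qed

lemma smooth_fst: 
  fixes f :: "'a::euclidean_space \<Rightarrow> complex" 
  assumes "smooth f" shows "smooth (\<lambda>z::'a \<times> 'b::euclidean_space. f (fst z))"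
  by (rule smooth_comp_linear[where L = fst and f = f]) (auto simp: assms Basis_prod_def linear_fst)

lemma smooth_snd: 
  fixes f :: "'b::euclidean_space \<Rightarrow> complex" 
  assumes "smooth f" shows "smooth (\<lambda>z::'a::euclidean_space \<times> 'b. f (snd z))"
  by (rule smooth_comp_linear[where L = snd and f = f]) (auto simp: assms Basis_prod_def linear_snd)

lemma smooth_inner_Basis: 
  assumes "smooth f" "b \<in> Basis" shows "smooth (\<lambda>x. f (x \<bullet> b))"
proof (rule smooth_comp_linear[where L = "\<lambda>x. x \<bullet> b" and f = f])
  show "linear (\<lambda>x. x \<bullet> b)" by (simp add: linear_conv_bounded_linear bounded_linear_inner_left)
qed (use assms in \<open>auto simp: inner_Basis\<close>)

lemma smooth_real_deriv:
  fixes f :: "real \<Rightarrow> complex"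
  assumes d: "\<And>t. (f has_vector_derivative g t) (at t)" and g: "smooth g"
  shows "smooth f"
proof (rule smooth_coinduct[of f "insert f {g. smooth g}"])
  have "continuous_on UNIV f"
    using d by (intro continuous_at_imp_continuous_on) (auto intro: has_vector_derivative_continuous)
  then show "continuous_on UNIV h" if "h \<in> insert f {g. smooth g}" for h
    using that smooth_continuous by auto
  show "\<exists>k\<in>insert f {g. smooth g}. has_pd h v k" if "h \<in> insert f {g. smooth g}" "v \<in> Basis" for h v
  proof (cases "h = f")
    case True
    then show ?thesis using that d g by (intro bexI[of _ g]) (auto simp: has_pd_real_iff)
  next
    case False
    then show ?thesis using that smooth_has_pd[of h v] smooth_pd[of h v] by auto
  qed
qed simp

lemma smooth_affine:
  assumes "smooth (f :: real \<Rightarrow> complex)" shows "smooth (\<lambda>t. f (c * t + d))"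
\<comment> \<open>The scalar \<open>k\<close> collects the powers of \<open>c\<close> produced by
  the chain rule.\<close>
proof (rule smooth_coinduct[of _ "{(\<lambda>t. k * f (c * t + d)) |f k. smooth f}"])
  show "(\<lambda>t. f (c * t + d)) \<in> {(\<lambda>t. k * f (c * t + d)) |f k. smooth f}" 
    using assms by (intro CollectI exI[of _ f] exI[of _ 1]) simp
next
  fix h assume "h \<in> {(\<lambda>t. k * f (c * t + d)) |f k. smooth f}"
  then obtain f k where f: "smooth f" "h = (\<lambda>t. k * f (c * t + d))" by auto
  have "continuous_on UNIV (\<lambda>t. f (c * t + d))"
    by (rule continuous_on_compose2[OF smooth_continuous[OF f(1), of UNIV]]) (auto intro!: continuous_on_add continuous_on_mult)
  then show "continuous_on UNIV h" unfolding f(2) by (intro continuous_on_mult continuous_on_const)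
next
  fix h v assume "h \<in> {(\<lambda>t. k * f (c * t + d)) |f k. smooth f}" and "v \<in> (Basis::real set)"
  then obtain f k where f: "smooth f" "h = (\<lambda>t. k * f (c * t + d))" and v: "v = 1" by auto
  have "(h has_vector_derivative (k * of_real c) * pd 1 f (c * t + d)) (at t)" for t
  proof -
    have "(f \<circ> (\<lambda>t. c * t + d) has_vector_derivative c *\<^sub>R pd 1 f (c * t + d)) (at t)"
      using smooth_has_pd[OF f(1), of 1] unfolding has_pd_real_iff
      by (intro vector_diff_chain_at) (auto intro!: derivative_eq_intros)
    from has_vector_derivative_mult_right[OF this, of k] show ?thesis 
      by (simp add: f(2) o_def scaleR_conv_of_real mult.assoc)
  qed
  then have "has_pd h v (\<lambda>t. (k * of_real c) * pd 1 f (c * t + d))" by (simp add: v has_pd_real_iff)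
  then show "\<exists>g\<in>{(\<lambda>t. k * f (c * t + d)) |f k. smooth f}. has_pd h v g"
    using smooth_pd[OF f(1), of 1] by (intro bexI[of _ "\<lambda>t. (k * of_real c) * pd 1 f (c * t + d)"]) auto
qed

section \<open>Locality of derivatives, supports and test functions\<close>

lemma has_pd_cong_open:
  fixes f g :: "'a::real_normed_vector \<Rightarrow> complex"
  assumes "open S" "x \<in> S" "\<And>y. y \<in> S \<Longrightarrow> f y = g y"
  shows "((\<lambda>h::real. f (x + h *\<^sub>R v)) has_vector_derivative d) (at 0) \<longleftrightarrow>
         ((\<lambda>h::real. g (x + h *\<^sub>R v)) has_vector_derivative d) (at 0)"
proof -
  define T where "T = {h::real. x + h *\<^sub>R v \<in> S}"
  have "open T" unfolding T_def vimage_def[symmetric]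
    by (rule open_vimage[OF assms(1)]) (intro continuous_intros)
  then show ?thesis using assms
    by (auto simp: T_def intro: has_vector_derivative_transform_within_open[of _ _ _ T])
qed

lemma pd_cong_open:
  fixes f g :: "'a::real_normed_vector \<Rightarrow> complex"
  assumes "open S" "x \<in> S" "\<And>y. y \<in> S \<Longrightarrow> f y = g y"
  shows "pd v f x = pd v g x"
  unfolding pd_def vector_derivative_def by (subst has_pd_cong_open[OF assms]) simp_all

lemma iterpd_cong_open:
  fixes f g :: "'a::real_normed_vector \<Rightarrow> complex"
  assumes "open S" "x \<in> S" "\<And>y. y \<in> S \<Longrightarrow> f y = g y"
  shows "iterpd vs f x = iterpd vs g x"
  using assms(2)
proof (induction vs arbitrary: x)
  case Nil
  then show ?case using assms(3) by simp
next
  case (Cons v vs)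
  show ?case unfolding iterpd_Cons by (rule pd_cong_open[OF assms(1) Cons.prems Cons.IH])
qed

lemma iterpd_zero [simp]: "iterpd vs (\<lambda>_. 0) = (\<lambda>_. 0)"
  by (induction vs) (auto simp: iterpd_Cons has_pd_imp_pd[OF has_pd_const])

lemma iterpd_eq_0_off:
  fixes f :: "'a::real_normed_vector \<Rightarrow> complex"
  assumes "closed S" "x \<notin> S" "\<And>y. y \<notin> S \<Longrightarrow> f y = 0"
  shows "iterpd vs f x = 0"
proof -
  have "iterpd vs f x = iterpd vs (\<lambda>_. 0) x"
    by (rule iterpd_cong_open[of "- S"]) (use assms in auto)
  then show ?thesis by simp
qed

lemma tsupp_subset: "closed S \<Longrightarrow> (\<And>y. y \<notin> S \<Longrightarrow> f y = 0) \<Longrightarrow> tsupp f \<subseteq> S"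
  unfolding tsupp_def by (intro closure_minimal) auto

lemma not_in_tsupp: "x \<notin> tsupp f \<Longrightarrow> f x = 0"
  unfolding tsupp_def using closure_subset[of "{x. f x \<noteq> 0}"] by auto

lemma closed_tsupp: "closed (tsupp f)"
  by (simp add: tsupp_def)

lemma tsupp_iterpd: "tsupp (iterpd vs f) \<subseteq> tsupp f"
  by (rule tsupp_subset[OF closed_tsupp]) (rule iterpd_eq_0_off[OF closed_tsupp], auto simp: not_in_tsupp)

lemma tsupp_pd: "tsupp (pd v f) \<subseteq> tsupp f"
  using tsupp_iterpd[of "[v]" f] by (simp add: iterpd_Cons)

lemma testI:
  assumes "smooth f" "compact K" "\<And>y. y \<notin> K \<Longrightarrow> f y = 0"
  shows "test f" "tsupp f \<subseteq> K"
proof -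
  show *: "tsupp f \<subseteq> K" using assms by (intro tsupp_subset) (auto simp: compact_imp_closed)
  have "compact (K \<inter> tsupp f)" using assms(2) closed_tsupp by (rule compact_Int_closed)
  then show "test f" unfolding test_def using assms(1) * by (simp add: inf.absorb2)
qed

lemma test_smooth: "test f \<Longrightarrow> smooth f"
  by (simp add: test_def)

lemma test_lincomb: 
  assumes "test f" "test g" shows "test (\<lambda>x. a * f x + b * g x)"
  using assms by (intro testI(1)[of _ "tsupp f \<union> tsupp g"]) 
    (auto simp: test_def not_in_tsupp intro: smooth_add smooth_cmult)

lemma test_mult: "smooth f \<Longrightarrow> test g \<Longrightarrow> test (\<lambda>x. f x * g x)"
  by (intro testI(1)[of _ "tsupp g"]) (auto simp: test_def not_in_tsupp intro: smooth_mult)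

lemma test_cmult: "test g \<Longrightarrow> test (\<lambda>x. c * g x)"
  by (intro test_mult smooth_const)

lemma test_zero [simp]: "test (\<lambda>_. 0)"
  by (rule testI(1)[of _ "{}"]) (auto intro: smooth_const)

lemma test_pd: 
  assumes "test f" "v \<in> Basis" shows "test (pd v f)"
  by (rule testI(1)[of _ "tsupp f"]) 
    (use assms tsupp_pd in \<open>auto simp: test_def smooth_pd intro: not_in_tsupp\<close>)

lemma test_sum: "(\<And>i. i \<in> I \<Longrightarrow> test (f i)) \<Longrightarrow> test (\<lambda>x. \<Sum>i\<in>I. f i x)"
proof (induction I rule: infinite_finite_induct)
  case (insert i I)
  then show ?case using test_lincomb[of "f i" "\<lambda>x. \<Sum>i\<in>I. f i x" 1 1] by simp
qed auto

lemma test_funpow_pd: "test f \<Longrightarrow> v \<in> Basis \<Longrightarrow> test ((pd v ^^ n) f)"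
  by (induction n) (auto simp: test_pd)

text \<open>Write the increment of \<open>f\<close> in direction \<open>v\<close> as an integral of
  \<open>pd v f\<close>, differentiate under the integral in direction \<open>w\<close>, and then
  differentiate in the upper limit \<open>s\<close> at 0.\<close>

lemma pd_commute:
  fixes f :: "'a::euclidean_space \<Rightarrow> complex"
  assumes f: "smooth f" and v: "v \<in> Basis" and w: "w \<in> Basis"
  shows "pd v (pd w f) = pd w (pd v f)"
proof
  fix x
  define K where "K = (\<lambda>s::real. pd w (pd v f) (x + s *\<^sub>R v))"
  have cont: "continuous_on A (\<lambda>y. g (h y))" 
    if "smooth g" "continuous_on A h" for g :: "'a \<Rightarrow> complex" and h :: "'c::topological_space \<Rightarrow> 'a" and A
    by (rule continuous_on_compose2[OF smooth_continuous[OF that(1), of UNIV] that(2)]) simp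
  have *: "pd w f (x + s *\<^sub>R v) = pd w f x + integral {0..s} K" if "0 \<le> s" for s
  proof -
    have 1: "f (x + t *\<^sub>R w + s *\<^sub>R v) - f (x + t *\<^sub>R w) = integral (cbox 0 s) (\<lambda>\<sigma>. pd v f (x + t *\<^sub>R w + \<sigma> *\<^sub>R v))" for t
      using fundamental_theorem_of_calculus[OF that has_pd_along[OF smooth_has_pd[OF f v], of "x + t *\<^sub>R w"]]
      by (simp add: integral_unique)
    have "((\<lambda>t. integral (cbox 0 s) (\<lambda>\<sigma>. pd v f (x + t *\<^sub>R w + \<sigma> *\<^sub>R v))) has_vector_derivative 
        integral (cbox 0 s) (\<lambda>\<sigma>. pd w (pd v f) (x + 0 *\<^sub>R w + \<sigma> *\<^sub>R v))) (at 0 within UNIV)"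
    proof (rule leibniz_rule_vector_derivative)
      show "((\<lambda>t. pd v f (x + t *\<^sub>R w + \<sigma> *\<^sub>R v)) has_vector_derivative pd w (pd v f) (x + t *\<^sub>R w + \<sigma> *\<^sub>R v)) (at t)" for t \<sigma>
        using has_pd_along[OF smooth_has_pd[OF smooth_pd[OF f v] w], of "x + \<sigma> *\<^sub>R v" t UNIV] 
        by (simp add: add_ac)
      show "(\<lambda>\<sigma>. pd v f (x + t *\<^sub>R w + \<sigma> *\<^sub>R v)) integrable_on cbox 0 s" for t
        by (intro integrable_continuous cont smooth_pd f v continuous_intros)
      show "continuous_on (UNIV \<times> cbox 0 s) (\<lambda>(t, \<sigma>). pd w (pd v f) (x + t *\<^sub>R w + \<sigma> *\<^sub>R v))"
        unfolding split_beta by (intro cont smooth_pd f v w continuous_intros)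
    qed auto
    then have "((\<lambda>t. f (x + t *\<^sub>R w + s *\<^sub>R v) - f (x + t *\<^sub>R w)) has_vector_derivative integral {0..s} K) (at 0)"
      by (simp add: 1 K_def)
    moreover have "((\<lambda>t. f (x + s *\<^sub>R v + t *\<^sub>R w) - f (x + t *\<^sub>R w)) has_vector_derivative 
        pd w f (x + s *\<^sub>R v) - pd w f x) (at 0)"
      using smooth_has_pd[OF f w] unfolding has_pd_def by (intro has_vector_derivative_diff) auto
    then have "((\<lambda>t. f (x + t *\<^sub>R w + s *\<^sub>R v) - f (x + t *\<^sub>R w)) has_vector_derivative 
        pd w f (x + s *\<^sub>R v) - pd w f x) (at 0)" by (simp add: add_ac)
    ultimately show ?thesis using vector_derivative_unique_at by fastforce
  qed
  have contK: "continuous_on {0..1} K" unfolding K_def by (intro cont smooth_pd f v w continuous_intros)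
  have "((\<lambda>s. pd w f x + integral {0..s} K) has_vector_derivative 0 + K 0) (at 0 within {0..1})"
    by (intro has_vector_derivative_add integral_has_vector_derivative contK) auto
  then have "((\<lambda>s. pd w f x + integral {0..s} K) has_vector_derivative K 0) (at 0 within {0..1})" by simp
  then have 2: "((\<lambda>s. pd w f (x + s *\<^sub>R v)) has_vector_derivative K 0) (at 0 within {0..1})"
    by (rule has_vector_derivative_transform[rotated 2]) (use * in auto)
  \<comment> \<open>Smoothness already provides the two-sided derivative at 0, so its value may be
    read off on the one-sided interval where the integral formula holds.\<close>
  have 3: "((\<lambda>s. pd w f (x + s *\<^sub>R v)) has_vector_derivative pd v (pd w f) x) (at 0 within {0..1})"
    using has_pd_along[OF smooth_has_pd[OF smooth_pd[OF f w] v], of x 0] by simp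
  have "at (0::real) within {0..1} \<noteq> bot" by (simp add: at_within_Icc_at_right trivial_limit_at_right_real)
  from vector_derivative_unique_within[OF this 3 2] show "pd v (pd w f) x = pd w (pd v f) x"
    by (simp add: K_def)
qed

lemma iterpd_pd_commute:
  assumes "smooth f" "set vs \<subseteq> Basis" "w \<in> Basis"
  shows "iterpd vs (pd w f) = pd w (iterpd vs f)"
  using assms by (induction vs) (auto simp: iterpd_Cons pd_commute[of _ _ w] smooth_iterpd)

text \<open>Moves one derivative innermost, so that an estimate for the derivatives of
  \<open>pd w f\<close> becomes one for those derivatives of \<open>f\<close> that involve
  \<open>w\<close>.\<close>

lemma iterpd_remove1:
  assumes "smooth f" "set vs \<subseteq> Basis" "w \<in> set vs"
  shows "iterpd vs f = iterpd (remove1 w vs) (pd w f)"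
  using assms(2,3)
proof (induction vs)
  case (Cons v vs)
  show ?case
  proof (cases "v = w")
    case True
    then show ?thesis using Cons.prems assms(1) by (simp add: iterpd_Cons iterpd_pd_commute)
  next
    case False
    then show ?thesis using Cons by (simp add: iterpd_Cons)
  qed
qed simp

section \<open>Cutoff functions\<close>

text \<open>The polynomial factor in \<open>1 / t\<close> makes the family closed under
  differentiation: with \<open>s = 1 / t\<close>, the derivative replaces \<open>q(s)\<close> by
  \<open>(q(s) - q'(s)) * s^2\<close>.\<close>

definition ebump :: "real poly \<Rightarrow> real \<Rightarrow> real" where
  "ebump q t = (if t > 0 then poly q (1 / t) * exp (- 1 / t) else 0)"

lemma poly_div_exp_tendsto_0: "((\<lambda>s. poly q s / exp s) \<longlongrightarrow> (0::real)) at_top"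
proof -
  have "((\<lambda>s. \<Sum>i\<le>degree q. coeff q i * (s ^ i / exp s)) \<longlongrightarrow> (\<Sum>i\<le>degree q. coeff q i * 0)) at_top"
    by (intro tendsto_sum tendsto_mult tendsto_const tendsto_power_div_exp_0)
  then show ?thesis by (simp add: poly_altdef sum_divide_distrib)
qed

lemma ebump_tendsto_0: "(ebump q \<longlongrightarrow> 0) (at 0)"
proof -
  have "((\<lambda>t. poly q (inverse t) / exp (inverse t)) \<longlongrightarrow> 0) (at_right (0::real))"
    by (rule filterlim_compose[OF poly_div_exp_tendsto_0 filterlim_inverse_at_top_right])
  then have "(ebump q \<longlongrightarrow> 0) (at_right 0)"
    by (rule Lim_transform_eventually)
      (auto simp: ebump_def eventually_at_right_less exp_minus divide_simps intro!: eventually_at_rightI[of 0 1])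
  moreover have "(ebump q \<longlongrightarrow> 0) (at_left 0)"
    by (rule Lim_transform_eventually[OF tendsto_const])
      (auto simp: ebump_def intro!: eventually_at_leftI[of "-1" 0])
  ultimately show ?thesis by (simp add: filterlim_at_split)
qed

lemma ebump_deriv:
  "(ebump q has_real_derivative ebump ((q - pderiv q) * [:0, 0, 1:]) t) (at t)"
proof -
  consider "t < 0" | "t > 0" | "t = 0" by linarith
  then show ?thesis
  proof cases
    case 1
    have "((\<lambda>_. 0) has_real_derivative 0) (at t)" by simp
    then have "(ebump q has_real_derivative 0) (at t)"
      by (rule has_field_derivative_transform_within_open[of _ _ _ "{..<0}"]) (use 1 in \<open>auto simp: ebump_def\<close>)
    then show ?thesis using 1 by (simp add: ebump_def)
  next
    case 2
    have "((\<lambda>t. poly q (1 / t) * exp (- 1 / t)) has_real_derivative 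
       ebump ((q - pderiv q) * [:0, 0, 1:]) t) (at t)"
      using 2 by (auto intro!: derivative_eq_intros simp: ebump_def field_simps power2_eq_square)
    then show ?thesis
      by (rule has_field_derivative_transform_within_open[of _ _ _ "{0<..}"]) (use 2 in \<open>auto simp: ebump_def\<close>)
  next
    case 3
    \<comment> \<open>Dividing by \<open>h\<close> multiplies the polynomial by the variable
      \<open>1 / h\<close>, so the difference quotient at 0 is again in the family and tends to
      0.\<close>
    have "(\<lambda>h. (ebump q (0 + h) - ebump q 0) / h) = ebump (q * [:0, 1:])"
      by (auto simp: fun_eq_iff ebump_def)
    then show ?thesis using ebump_tendsto_0[of "q * [:0, 1:]"] 3
      by (simp add: DERIV_def ebump_def)
  qed
qed

lemma smooth_ebump: "smooth (\<lambda>t. of_real (ebump q t))"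
proof (rule smooth_coinduct[of _ "range (\<lambda>q t. of_real (ebump q t))"])
  have d: "((\<lambda>t. complex_of_real (ebump q t)) has_vector_derivative of_real (ebump ((q - pderiv q) * [:0, 0, 1:]) t)) (at t)" for q t
    using ebump_deriv[of q t] by (simp add: has_real_derivative_iff_has_vector_derivative has_vector_derivative_of_real)
  show "continuous_on UNIV f" if "f \<in> range (\<lambda>q t. complex_of_real (ebump q t))" for f
    using that d by (auto intro!: continuous_at_imp_continuous_on has_vector_derivative_continuous)
  show "\<exists>g\<in>range (\<lambda>q t. complex_of_real (ebump q t)). has_pd f v g" 
    if "f \<in> range (\<lambda>q t. complex_of_real (ebump q t))" "v \<in> Basis" for f v
    using that d by (auto simp: has_pd_real_iff) 
qed auto

text \<open>The constant \<open>c\<close> is the total integral of \<open>f\<close>, the obstruction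
  to a compactly supported antiderivative; it is returned so that users can normalise by it or
  cancel it.\<close>

lemma compact_support_antiderivative:
  fixes f :: "real \<Rightarrow> complex"
  assumes f: "smooth f" and 0: "\<And>t. t \<notin> {a..b} \<Longrightarrow> f t = 0" and "a \<le> b"
  obtains F c where "smooth F" "\<And>t. (F has_vector_derivative f t) (at t)" 
    "\<And>t. t \<le> a \<Longrightarrow> F t = 0" "\<And>t. t \<ge> b \<Longrightarrow> F t = c"
proof -
  \<comment> \<open>Starting at \<open>a - 1\<close> and not at \<open>a\<close> makes every
    \<open>t \<ge> a\<close> an interior point of the interval on which the integral is
    differentiated.\<close>
  define F where "F t = integral {a-1..t} f" for t
  have fa: "f t = 0" if "t < a" for t using 0[of t] that by auto
  have Fa': "F t = 0" if "t < a" for t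
  proof -
    have "integral {a-1..t} f = integral {a-1..t} (\<lambda>_. 0)" using that fa by (intro integral_cong) auto
    then show ?thesis by (simp add: F_def)
  qed
  have d: "(F has_vector_derivative f t) (at t)" for t
  proof (cases "t < a")
    case True
    have "((\<lambda>_. 0) has_vector_derivative f t) (at t)" using True fa by simp
    then show ?thesis
      by (rule has_vector_derivative_transform_within_open[of _ _ _ "{..<a}"]) (use True Fa' in auto)
  next
    case False
    have "(F has_vector_derivative f t) (at t within {a-1..t+1})"
      unfolding F_def by (rule integral_has_vector_derivative) (use False smooth_continuous[OF f] in auto)
    then show ?thesis using False by (simp add: at_within_Icc_at)
  qed
  have cF: "continuous_on A F" for A
    using d by (intro continuous_at_imp_continuous_on) (auto intro: has_vector_derivative_continuous)
  have "F t = F b" if "t \<ge> b" for t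
  proof -
    have "(f has_integral (F t - F b)) {b..t}"
      by (rule fundamental_theorem_of_calculus) (use that d in \<open>auto intro: has_vector_derivative_at_within\<close>)
    moreover have "(f has_integral 0) {b..t}"
      by (rule has_integral_spike[of "{b}" _ _ "\<lambda>_. 0"]) (use 0 in auto)
    ultimately have "F t - F b = 0" by (rule has_integral_unique)
    then show ?thesis by simp
  qed
  moreover have "F t = 0" if "t \<le> a" for t
  proof -
    have "F a = 0" 
    proof (rule continuous_constant_on_closure[of "{..<a}" F 0 a])
      show "continuous_on (closure {..<a}) F" by (rule cF)
    qed (use Fa' in \<open>auto simp: closure_lessThan\<close>)
    then show ?thesis using Fa'[of t] that by (cases "t = a") auto
  qed
  ultimately show thesis using that[of F "F b"] smooth_real_deriv[OF d f] d by blast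
qed

lemma smooth_step_exists:
  obtains E :: "real \<Rightarrow> complex" where "smooth E" "\<And>t. t \<le> 0 \<Longrightarrow> E t = 0" "\<And>t. t \<ge> 1 \<Longrightarrow> E t = 1"
proof -
  \<comment> \<open>A non-negative bump on \<open>[0, 1]\<close>. It is positive at
    \<open>1/2\<close>, so its total integral \<open>c\<close> is non-zero and the step is its
    antiderivative divided by \<open>c\<close>.\<close>
  define \<eta> where "\<eta> t = of_real (ebump 1 t) * complex_of_real (ebump 1 ((-1) * t + 1))" for t
  have sm: "smooth \<eta>" unfolding \<eta>_def
    by (intro smooth_mult smooth_ebump smooth_affine[of "\<lambda>t. complex_of_real (ebump 1 t)"])
  have z: "\<eta> t = 0" if "t \<notin> {0..1}" for t using that by (auto simp: \<eta>_def ebump_def)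
  obtain F c where F: "smooth F" "\<And>t. (F has_vector_derivative \<eta> t) (at t)"
    "\<And>t. t \<le> 0 \<Longrightarrow> F t = 0" "\<And>t. t \<ge> 1 \<Longrightarrow> F t = c"
    using compact_support_antiderivative[OF sm z] by (metis zero_le_one)
  have "c \<noteq> 0"
  proof
    assume "c = 0"
    have "(\<eta> has_integral (F 1 - F 0)) {0..1}"
      by (rule fundamental_theorem_of_calculus) (use F(2) in \<open>auto intro: has_vector_derivative_at_within\<close>)
    then have "(\<eta> has_integral 0) {0..1}" using F(3)[of 0] F(4)[of 1] \<open>c = 0\<close> by simp
    then have "((\<lambda>t. Re (\<eta> t)) has_integral Re 0) {0..1}" by (rule has_integral_Re)
    moreover have "continuous_on {0..1} (\<lambda>t. Re (\<eta> t))" using smooth_continuous[OF sm] by (intro continuous_intros)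
    ultimately have "Re (\<eta> (1/2)) = 0"
      by (intro has_integral_0_cbox_imp_0[of 0 1 "\<lambda>t. Re (\<eta> t)" "1/2"]) (auto simp: \<eta>_def ebump_def)
    then show False by (simp add: \<eta>_def ebump_def)
  qed
  have "smooth (\<lambda>t. (1 / c) * F t)" by (intro smooth_cmult F)
  then show thesis using that[of "\<lambda>t. (1 / c) * F t"] F \<open>c \<noteq> 0\<close> by auto
qed

lemma real_cutoff_exists:
  obtains g :: "real \<Rightarrow> complex" where "smooth g" "\<And>t. \<bar>t\<bar> \<le> R \<Longrightarrow> g t = 1" "\<And>t. \<bar>t\<bar> \<ge> R + 1 \<Longrightarrow> g t = 0"
proof -
  obtain E :: "real \<Rightarrow> complex" where E: "smooth E" "\<And>t. t \<le> 0 \<Longrightarrow> E t = 0" "\<And>t. t \<ge> 1 \<Longrightarrow> E t = 1"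
    using smooth_step_exists by metis
  show thesis
  proof (rule that[of "\<lambda>t. E (1 * t + (R + 1)) * E ((-1) * t + (R + 1))"])
    show "smooth (\<lambda>t. E (1 * t + (R + 1)) * E ((-1) * t + (R + 1)))"
      by (intro smooth_mult smooth_affine E)
  qed (use E in \<open>auto simp: abs_le_iff abs_if split: if_splits\<close>)
qed

text \<open>Cubes fit the coordinates: cutoffs are products of one-variable cutoffs, and from any
  point a face can be reached along a basis direction without leaving the cube.\<close>

definition cube :: "real \<Rightarrow> 'a::euclidean_space set" where
  "cube r = {x. \<forall>b\<in>Basis. \<bar>x \<bullet> b\<bar> \<le> r}"

definition open_cube :: "real \<Rightarrow> 'a::euclidean_space set" where
  "open_cube r = {x. \<forall>b\<in>Basis. \<bar>x \<bullet> b\<bar> < r}"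

lemma compact_cube: "compact (cube r :: 'a::euclidean_space set)"
proof -
  have "cube r = cbox (\<Sum>b\<in>Basis. (- r) *\<^sub>R b) (\<Sum>b\<in>Basis. r *\<^sub>R b :: 'a)"
    by (rule set_eqI) (simp only: cube_def mem_box mem_Collect_eq, intro ball_cong refl, simp only: inner_sum_left_Basis, auto simp: abs_le_iff)
  then show ?thesis by (metis compact_cbox)
qed

lemma open_open_cube: "open (open_cube r :: 'a::euclidean_space set)"
proof -
  have "open_cube r = box (\<Sum>b\<in>Basis. (- r) *\<^sub>R b) (\<Sum>b\<in>Basis. r *\<^sub>R b :: 'a)"
    by (rule set_eqI) (simp only: open_cube_def mem_box mem_Collect_eq, intro ball_cong refl, simp only: inner_sum_left_Basis, auto simp: abs_less_iff)
  then show ?thesis by (metis open_box)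
qed

lemma open_cube_subset_cube: "open_cube r \<subseteq> cube r"
  by (auto simp: cube_def open_cube_def less_imp_le)

lemma compact_subset_open_cube:
  fixes K :: "'a::euclidean_space set"
  assumes "compact K"
  obtains r where "r > 0" "K \<subseteq> open_cube r"
proof -
  obtain B where B: "\<And>x. x \<in> K \<Longrightarrow> norm x \<le> B" using compact_imp_bounded[OF assms] by (auto simp: bounded_iff)
  have "\<bar>x \<bullet> b\<bar> < \<bar>B\<bar> + 1" if "x \<in> K" "b \<in> Basis" for x b 
    using Basis_le_norm[OF that(2), of x] B[OF that(1)] by linarith
  then show thesis by (intro that[of "\<bar>B\<bar> + 1"]) (auto simp: open_cube_def)
qed

lemma cutoff_exists:
  obtains g :: "'a::euclidean_space \<Rightarrow> complex" where "test g" "\<And>x. x \<in> cube r \<Longrightarrow> g x = 1" "tsupp g \<subseteq> cube (r + 1)"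
proof -
  obtain h :: "real \<Rightarrow> complex" where h: "smooth h" "\<And>t. \<bar>t\<bar> \<le> r \<Longrightarrow> h t = 1" "\<And>t. \<bar>t\<bar> \<ge> r + 1 \<Longrightarrow> h t = 0"
    using real_cutoff_exists by metis
  define g where "g x = (\<Prod>b\<in>Basis. h (x \<bullet> b))" for x :: 'a
  have sm: "smooth g" unfolding g_def by (intro smooth_prod smooth_inner_Basis h)
  have z: "g x = 0" if x: "x \<notin> cube (r + 1)" for x
  proof -
    from x obtain b where "b \<in> Basis" "\<bar>x \<bullet> b\<bar> > r + 1" by (auto simp: cube_def not_le)
    then show ?thesis using h(3)[of "x \<bullet> b"] by (auto simp: g_def)
  qed
  have one: "g x = 1" if "x \<in> cube r" for x
    using that h(2) by (auto simp: g_def cube_def intro!: prod.neutral)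
  from testI[OF sm compact_cube z] one show thesis by (intro that[of g])
qed

lemma cutoff_on_compact:
  fixes K :: "'a::euclidean_space set"
  assumes "compact K"
  obtains g :: "'a \<Rightarrow> complex" and S where "test g" "open S" "K \<subseteq> S" "\<And>x. x \<in> S \<Longrightarrow> g x = 1"
proof -
  obtain r where r: "K \<subseteq> open_cube r" using compact_subset_open_cube[OF assms] by metis
  obtain g :: "'a \<Rightarrow> complex" where "test g" "\<And>x. x \<in> cube r \<Longrightarrow> g x = 1"
    using cutoff_exists[of r] by metis
  then show thesis using that[of g "open_cube r"] r open_cube_subset_cube open_open_cube by blast
qed

section \<open>Seminorms and density of polynomials\<close>

abbreviation words :: "nat \<Rightarrow> 'a::euclidean_space list set" where
  "words N \<equiv> {vs. set vs \<subseteq> Basis \<and> length vs \<le> N}"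

text \<open>A pointwise substitute for the sum of suprema \<open>sn\<close>; for non-empty compact
  \<open>K\<close> and smooth \<open>f\<close> the two control each other up to the factor
  \<open>card (words N)\<close>.\<close>

definition small :: "nat \<Rightarrow> 'a::euclidean_space set \<Rightarrow> real \<Rightarrow> ('a \<Rightarrow> complex) \<Rightarrow> bool" where
  "small N K e f \<longleftrightarrow> (\<forall>vs\<in>words N. \<forall>x\<in>K. norm (iterpd vs f x) \<le> e)"

lemma smallD: "small N K e f \<Longrightarrow> set vs \<subseteq> Basis \<Longrightarrow> length vs \<le> N \<Longrightarrow> x \<in> K \<Longrightarrow> norm (iterpd vs f x) \<le> e"
  by (auto simp: small_def)

lemma finite_words: "finite (words N :: 'a::euclidean_space list set)"
  by (rule finite_lists_length_le) simp

lemma bdd_above_iterpd: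
  fixes f :: "'a::euclidean_space \<Rightarrow> complex"
  assumes "smooth f" "compact K" "set vs \<subseteq> Basis"
  shows "bdd_above ((\<lambda>x. norm (iterpd vs f x)) ` K)"
  by (intro bounded_imp_bdd_above compact_imp_bounded compact_continuous_image continuous_on_norm
    smooth_continuous smooth_iterpd assms)

lemma small_sn:
  fixes f :: "'a::euclidean_space \<Rightarrow> complex"
  assumes f: "smooth f" and K: "compact K"
  shows "small N K (sn N K f) f"
  unfolding small_def
proof (intro ballI)
  fix vs :: "'a list" and x assume vs: "vs \<in> words N" and x: "x \<in> K"
  have "norm (iterpd ws f x) \<le> Sup ((\<lambda>x. norm (iterpd ws f x)) ` K)" if "ws \<in> words N" for ws
    by (rule cSup_upper) (use x bdd_above_iterpd[OF f K] that in auto)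
  then have *: "0 \<le> Sup ((\<lambda>x. norm (iterpd ws f x)) ` K)" 
    "norm (iterpd ws f x) \<le> Sup ((\<lambda>x. norm (iterpd ws f x)) ` K)" if "ws \<in> words N" for ws
    using that norm_ge_zero order_trans by blast+
  have "Sup ((\<lambda>x. norm (iterpd vs f x)) ` K) \<le> sn N K f"
    unfolding sn_def by (rule member_le_sum[OF vs]) (use * finite_words in auto)
  then show "norm (iterpd vs f x) \<le> sn N K f" using *(2)[OF vs] by linarith
qed

lemma sn_le_small:
  fixes f :: "'a::euclidean_space \<Rightarrow> complex"
  assumes "small N K e f" "K \<noteq> {}"
  shows "sn N K f \<le> real (card (words N :: 'a list set)) * e"
  unfolding sn_def by (rule sum_bounded_above) (use assms in \<open>auto simp: small_def intro!: cSup_least\<close>)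

text \<open>The constant depends on \<rho>, \<open>K\<close> and the word, but not on
  \<open>g\<close> or \<open>e\<close>. Induction peels off the innermost derivative, where the
  Leibniz rule gives two products; \<rho> is generalised because one of them contains
  \<open>pd v \<rho>\<close>.\<close>

lemma iterpd_mult_bound:
  fixes \<rho> :: "'a::euclidean_space \<Rightarrow> complex"
  assumes "smooth \<rho>" "compact K" "set vs \<subseteq> Basis"
  shows "\<exists>C\<ge>0. \<forall>g e. smooth g \<longrightarrow> small (length vs) K e g \<longrightarrow> 
    (\<forall>x\<in>K. norm (iterpd vs (\<lambda>x. \<rho> x * g x) x) \<le> C * e)"
  using assms(1,3)
proof (induction vs arbitrary: \<rho> rule: rev_induct)
  case Nil
  have "bdd_above ((\<lambda>x. norm (\<rho> x)) ` K)" using bdd_above_iterpd[OF Nil(1) assms(2), of "[]"] by simp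
  then obtain C where C: "\<And>x. x \<in> K \<Longrightarrow> norm (\<rho> x) \<le> C" by (auto simp: bdd_above_def)
  show ?case
  proof (intro exI[of _ "max C 0"] conjI allI impI ballI)
    fix g e x assume "small (length ([]::'a list)) K e g" "x \<in> K"
    then show "norm (iterpd [] (\<lambda>x. \<rho> x * g x) x) \<le> max C 0 * e"
      using C[of x] smallD[of _ K e g "[]" x] by (auto simp: norm_mult intro!: mult_mono)
  qed simp
next
  case (snoc v vs)
  then have v: "v \<in> Basis" and vs: "set vs \<subseteq> Basis" by auto
  obtain C1 where C1: "C1 \<ge> 0" "\<And>g e x. smooth g \<Longrightarrow> small (length vs) K e g \<Longrightarrow> x \<in> K \<Longrightarrow>
     norm (iterpd vs (\<lambda>x. \<rho> x * g x) x) \<le> C1 * e" using snoc.IH[OF snoc.prems(1) vs] by blast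
  obtain C2 where C2: "C2 \<ge> 0" "\<And>g e x. smooth g \<Longrightarrow> small (length vs) K e g \<Longrightarrow> x \<in> K \<Longrightarrow>
     norm (iterpd vs (\<lambda>x. pd v \<rho> x * g x) x) \<le> C2 * e" using snoc.IH[OF smooth_pd[OF snoc.prems(1) v] vs] by blast
  show ?case
  proof (intro exI[of _ "C1 + C2"] conjI allI impI ballI)
    fix g e x assume g: "smooth g" and sm: "small (length (vs @ [v])) K e g" and x: "x \<in> K"
    have 1: "small (length vs) K e (pd v g)" unfolding small_def iterpd_snoc[symmetric]
      using sm v by (auto simp: small_def)
    have 2: "small (length vs) K e g" using sm by (auto simp: small_def)
    have "iterpd (vs @ [v]) (\<lambda>x. \<rho> x * g x) x = 
      iterpd vs (\<lambda>x. \<rho> x * pd v g x) x + iterpd vs (\<lambda>x. pd v \<rho> x * g x) x"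
      unfolding iterpd_snoc pd_mult[OF snoc.prems(1) g v]
      by (subst iterpd_add) (auto intro!: smooth_mult smooth_pd snoc.prems(1) g v simp: vs)
    then show "norm (iterpd (vs @ [v]) (\<lambda>x. \<rho> x * g x) x) \<le> (C1 + C2) * e"
      using C1(2)[OF smooth_pd[OF g v] 1 x] C2(2)[OF g 2 x] norm_triangle_ineq
      by (smt (verit, best) distrib_right)
  qed (use C1(1) C2(1) in auto)
qed

lemma small_mult:
  fixes \<rho> :: "'a::euclidean_space \<Rightarrow> complex"
  assumes "smooth \<rho>" "compact K"
  shows "\<exists>C\<ge>0. \<forall>g e. smooth g \<longrightarrow> small N K e g \<longrightarrow> small N K (C * e) (\<lambda>x. \<rho> x * g x)"
proof -
  have "\<forall>vs\<in>words N. \<exists>C\<ge>0. \<forall>g e. smooth g \<longrightarrow> small (length vs) K e g \<longrightarrow> 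
    (\<forall>x\<in>K. norm (iterpd vs (\<lambda>x. \<rho> x * g x) x) \<le> C * e)"
    using iterpd_mult_bound[OF assms] by blast
  then obtain C where C: "\<And>vs. vs \<in> words N \<Longrightarrow> C vs \<ge> 0" "\<And>vs g e x. vs \<in> words N \<Longrightarrow> 
    smooth g \<Longrightarrow> small (length vs) K e g \<Longrightarrow> x \<in> K \<Longrightarrow> norm (iterpd vs (\<lambda>x. \<rho> x * g x) x) \<le> C vs * e"
    unfolding bchoice_iff by blast
  show ?thesis
  proof (intro exI[of _ "sum C (words N)"] conjI allI impI)
    show "sum C (words N) \<ge> 0" using C(1) by (intro sum_nonneg)
    fix g e assume g: "smooth g" and sm: "small N K e g"
    show "small N K (sum C (words N) * e) (\<lambda>x. \<rho> x * g x)"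
      unfolding small_def
    proof (intro ballI)
      fix vs :: "'a list" and x assume vs: "vs \<in> words N" and x: "x \<in> K"
      have "norm (iterpd [] g x) \<le> e" by (rule smallD[OF sm]) (use x in auto)
      then have e: "0 \<le> e" using norm_ge_zero order_trans by blast
      have "norm (iterpd vs (\<lambda>x. \<rho> x * g x) x) \<le> C vs * e"
        by (rule C(2)[OF vs g _ x]) (use sm vs in \<open>auto simp: small_def\<close>)
      also have "\<dots> \<le> sum C (words N) * e"
        using e vs C(1) by (intro mult_right_mono member_le_sum) (auto simp: finite_words)
      finally show "norm (iterpd vs (\<lambda>x. \<rho> x * g x) x) \<le> sum C (words N) * e" .
    qed
  qed
qed

section \<open>Polynomials and their density in the smooth functions\<close>

text \<open>Dividing by the factorials makes a derivative lower one exponent with no numerical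
  factor, which keeps the later moment relations free of binomial coefficients.\<close>

definition dmono :: "('a::euclidean_space \<Rightarrow> nat) \<Rightarrow> 'a \<Rightarrow> complex" where
  "dmono k x = (\<Prod>b\<in>Basis. of_real ((x \<bullet> b) ^ k b / fact (k b)))"

inductive_set polys :: "('a::euclidean_space \<Rightarrow> complex) set" where
  dmono: "dmono k \<in> polys"
| add: "P \<in> polys \<Longrightarrow> Q \<in> polys \<Longrightarrow> (\<lambda>x. P x + Q x) \<in> polys"
| cmult: "P \<in> polys \<Longrightarrow> (\<lambda>x. c * P x) \<in> polys"

lemma smooth_of_real: "smooth complex_of_real"
  by (rule smooth_real_deriv[OF _ smooth_const[of 1]]) 
    (auto intro!: has_vector_derivative_real_field derivative_eq_intros)

lemma smooth_power: "smooth f \<Longrightarrow> smooth (\<lambda>x. f x ^ n)"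
  by (induction n) (auto intro: smooth_const smooth_mult)

lemma smooth_dmono: "smooth (dmono k)"
proof -
  have "smooth (\<lambda>t. complex_of_real (t ^ n / fact n))" for n
    using smooth_cmult[OF smooth_power[OF smooth_of_real, of n], of "1 / fact n"] by simp
  then show ?thesis unfolding dmono_def by (intro smooth_prod smooth_inner_Basis)
qed

lemma smooth_polys: "P \<in> polys \<Longrightarrow> smooth P"
  by (induction rule: polys.induct) (auto intro: smooth_dmono smooth_add smooth_cmult)

lemma has_pd_dmono:
  assumes b: "b \<in> Basis"
  shows "has_pd (dmono k) b (\<lambda>x. if k b = 0 then 0 else dmono (k(b := k b - 1)) x)"
  unfolding has_pd_def
proof
  fix x :: 'a
  define R where "R = (\<Prod>c\<in>Basis - {b}. complex_of_real ((x \<bullet> c) ^ k c / fact (k c)))"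
  have 1: "dmono k (x + h *\<^sub>R b) = of_real ((x \<bullet> b + h) ^ k b / fact (k b)) * R" for h
    unfolding dmono_def R_def using b
    by (subst prod.remove[of _ b]) (auto simp: inner_add_left inner_Basis intro!: prod.cong)
  have 2: "dmono (k(b := k b - 1)) x = of_real ((x \<bullet> b) ^ (k b - 1) / fact (k b - 1)) * R"
    unfolding dmono_def R_def using b
    by (subst prod.remove[of _ b]) (auto intro!: prod.cong)
  have "((\<lambda>h. (x \<bullet> b + h) ^ k b / fact (k b)) has_real_derivative 
      (if k b = 0 then 0 else (x \<bullet> b) ^ (k b - 1) / fact (k b - 1))) (at 0)"
  proof (cases "k b")
    case (Suc n)
    have "((\<lambda>h. x \<bullet> b + h) has_real_derivative 1) (at 0)" by (auto intro!: derivative_eq_intros)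
    from DERIV_power[OF this, of "Suc n"]
    have "((\<lambda>h. (x \<bullet> b + h) ^ Suc n / fact (Suc n)) has_real_derivative 
      (real (Suc n) * (x \<bullet> b) ^ n) / fact (Suc n)) (at 0)"
      by (intro DERIV_cdivide) (simp del: power_Suc)
    then show ?thesis using Suc by (simp add: field_simps del: of_nat_Suc)
  qed simp
  then have "((\<lambda>h. of_real ((x \<bullet> b + h) ^ k b / fact (k b)) * R) has_vector_derivative 
     of_real (if k b = 0 then 0 else (x \<bullet> b) ^ (k b - 1) / fact (k b - 1)) * R) (at 0)"
    by (intro has_vector_derivative_mult_left has_vector_derivative_of_real)
      (simp add: has_real_derivative_iff_has_vector_derivative)
  then show "((\<lambda>h. dmono k (x + h *\<^sub>R b)) has_vector_derivative 
     (if k b = 0 then 0 else dmono (k(b := k b - 1)) x)) (at 0)"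
    unfolding 1 2 by (simp split: if_splits)
qed

lemma pd_dmono: "b \<in> Basis \<Longrightarrow> pd b (dmono k) = (if k b = 0 then (\<lambda>_. 0) else dmono (k(b := k b - 1)))"
  by (simp add: has_pd_imp_pd[OF has_pd_dmono] fun_eq_iff)

lemma polys_const: "(\<lambda>_. c) \<in> polys"
proof -
  have "(\<lambda>x::'a. c * dmono (\<lambda>_. 0) x) \<in> polys" by (intro polys.intros)
  then show ?thesis by (simp add: dmono_def)
qed

lemma polys_sum: "(\<And>i. i \<in> I \<Longrightarrow> P i \<in> polys) \<Longrightarrow> (\<lambda>x. \<Sum>i\<in>I. P i x) \<in> polys"
  by (induction I rule: infinite_finite_induct) (auto intro: polys_const polys.intros)

lemma polys_inner:
  assumes "b \<in> Basis" shows "(\<lambda>x. of_real (x \<bullet> b)) \<in> polys"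
proof -
  have "dmono ((\<lambda>_. 0)(b := 1)) x = of_real (x \<bullet> b)" for x
    unfolding dmono_def using assms by (subst prod.remove[of _ b]) (auto intro!: prod.neutral)
  then have "dmono ((\<lambda>_. 0)(b := 1)) = (\<lambda>x. of_real (x \<bullet> b))" by (rule ext)
  then show ?thesis using polys.dmono by metis
qed

lemma dmono_mult: "dmono k x * dmono l x = 
   of_real (\<Prod>b\<in>Basis. fact (k b + l b) / (fact (k b) * fact (l b))) * dmono (\<lambda>b. k b + l b) x"
  unfolding dmono_def of_real_prod prod.distrib[symmetric] of_real_mult[symmetric]
  by (intro prod.cong refl arg_cong[where f = of_real]) (simp add: power_add)

lemma polys_mult:
  assumes "P \<in> polys" "Q \<in> polys" shows "(\<lambda>x. P x * Q x) \<in> polys"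
  using assms(1)
proof induction
  case (dmono k)
  show ?case using assms(2)
  proof induction
    case (dmono l)
    show ?case unfolding dmono_mult by (intro polys.intros)
  next
    case (add P Q)
    then show ?case using polys.add by (simp add: distrib_left)
  next
    case (cmult P c)
    then show ?case using polys.cmult[OF cmult(2), of c] by (simp add: mult_ac)
  qed
next
  case (add P1 P2)
  then show ?case using polys.add by (simp add: distrib_right)
next
  case (cmult P c)
  then show ?case using polys.cmult[OF cmult(2), of c] by (simp add: mult_ac)
qed

lemma polys_real_polynomial_function:
  assumes "real_polynomial_function (f :: 'a::euclidean_space \<Rightarrow> real)"
  shows "(\<lambda>x. of_real (f x)) \<in> polys"
  using assms
proof induction
  case (linear f)
  then interpret bounded_linear f .
  have *: "f x = (\<Sum>b\<in>Basis. f b * (x \<bullet> b))" for x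
    by (subst euclidean_representation[of x, symmetric]) (simp only: sum scaleR real_scaleR_def mult.commute)
  have "(\<lambda>x. complex_of_real (f x)) = (\<lambda>x. \<Sum>b\<in>Basis. of_real (f b) * of_real (x \<bullet> b))"
    by (intro ext, subst *) (simp only: of_real_sum of_real_mult)
  then show ?case by (simp add: polys_sum polys.cmult polys_inner)
next
  case (const c)
  then show ?case by (rule polys_const)
next
  case (add f g)
  then show ?case using polys.add by simp
next
  case (mult f g)
  then show ?case using polys_mult by simp
qed

lemma polys_uniformly_dense:
  fixes f :: "'a::euclidean_space \<Rightarrow> complex"
  assumes "compact S" "continuous_on S f" "0 < e"
  obtains P where "P \<in> polys" "\<And>x. x \<in> S \<Longrightarrow> norm (f x - P x) < e"
proof -
  obtain g where g: "real_polynomial_function g" "\<And>x. x \<in> S \<Longrightarrow> \<bar>Re (f x) - g x\<bar> < e / 2"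
    by (rule Stone_Weierstrass_real_polynomial_function[OF assms(1), of "\<lambda>x. Re (f x)" "e / 2"])
      (use assms in \<open>auto intro: continuous_intros\<close>)
  obtain h where h: "real_polynomial_function h" "\<And>x. x \<in> S \<Longrightarrow> \<bar>Im (f x) - h x\<bar> < e / 2"
    by (rule Stone_Weierstrass_real_polynomial_function[OF assms(1), of "\<lambda>x. Im (f x)" "e / 2"])
      (use assms in \<open>auto intro: continuous_intros\<close>)
  show thesis
  proof (rule that[of "\<lambda>x. of_real (g x) + \<i> * of_real (h x)"])
    show "(\<lambda>x. of_real (g x) + \<i> * of_real (h x)) \<in> polys"
      by (intro polys.intros polys_real_polynomial_function g h)
    fix x assume "x \<in> S"
    then show "norm (f x - (of_real (g x) + \<i> * of_real (h x))) < e"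
      using g(2)[of x] h(2)[of x] cmod_le[of "f x - (of_real (g x) + \<i> * of_real (h x))"] by simp
  qed
qed

lemma polys_antiderivative:
  assumes "Q \<in> polys" "b \<in> Basis"
  shows "\<exists>P\<in>polys. has_pd P b Q \<and> (\<forall>x. x \<bullet> b = r \<longrightarrow> P x = 0)"
  using assms(1)
proof induction
  case (dmono k)
  \<comment> \<open>The constant of integration: its monomial has exponent 0 in direction
    \<open>b\<close>, so it leaves the derivative alone and cancels the antiderivative on
    \<open>x \<bullet> b = r\<close>.\<close>
  define c where "c = complex_of_real (r ^ Suc (k b) / fact (Suc (k b)))"
  define P where "P x = dmono (k(b := Suc (k b))) x + (- c) * dmono (k(b := 0)) x" for x
  have "P \<in> polys" unfolding P_def by (intro polys.intros)
  moreover have "has_pd P b (dmono k)"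
  proof -
    have "has_pd P b (\<lambda>x. dmono k x + ((- c) * 0 + 0 * dmono (k(b := 0)) x))"
      unfolding P_def 
      using has_pd_dmono[OF assms(2), of "k(b := Suc (k b))"] has_pd_dmono[OF assms(2), of "k(b := 0)"]
      by (intro has_pd_add has_pd_mult has_pd_const) auto
    then show ?thesis by simp
  qed
  moreover have "P x = 0" if "x \<bullet> b = r" for x
  proof -
    define R where "R = (\<Prod>c\<in>Basis - {b}. complex_of_real ((x \<bullet> c) ^ k c / fact (k c)))"
    have "dmono (k(b := n)) x = of_real (r ^ n / fact n) * R" for n
      unfolding dmono_def R_def using assms(2) that
      by (subst prod.remove[of _ b]) (auto intro!: prod.cong)
    then show ?thesis by (simp add: P_def c_def)
  qed
  ultimately show ?case by blast
next
  case (add Q1 Q2)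
  then obtain P1 P2 where "P1 \<in> polys" "has_pd P1 b Q1" "\<forall>x. x \<bullet> b = r \<longrightarrow> P1 x = 0"
     "P2 \<in> polys" "has_pd P2 b Q2" "\<forall>x. x \<bullet> b = r \<longrightarrow> P2 x = 0" by blast
  then show ?case by (intro bexI[of _ "\<lambda>x. P1 x + P2 x"]) (auto intro: polys.intros has_pd_add)
next
  case (cmult Q c)
  then obtain P where P: "P \<in> polys" "has_pd P b Q" "\<forall>x. x \<bullet> b = r \<longrightarrow> P x = 0" by blast
  have "has_pd (\<lambda>x. c * P x) b (\<lambda>x. c * Q x + 0 * P x)" by (intro has_pd_mult has_pd_const P)
  then show ?case using P by (intro bexI[of _ "\<lambda>x. c * P x"]) (auto intro: polys.intros)
qed

text \<open>Derivatives in basis directions other than \<open>b\<close> are tangential to the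
  hyperplane, so they see only the zero values of \<open>P\<close> there.\<close>

lemma iterpd_eq_0_on_face:
  fixes P :: "'a::euclidean_space \<Rightarrow> complex"
  assumes "b \<in> Basis" "\<And>x. x \<bullet> b = r \<Longrightarrow> P x = 0" "set vs \<subseteq> Basis" "b \<notin> set vs" "x \<bullet> b = r"
  shows "iterpd vs P x = 0"
  using assms(3-5)
proof (induction vs arbitrary: x)
  case Nil
  then show ?case using assms(2) by simp
next
  case (Cons v vs)
  then have "(x + h *\<^sub>R v) \<bullet> b = r" for h using assms(1) by (auto simp: inner_add_left inner_Basis)
  then have "iterpd vs P (x + h *\<^sub>R v) = 0" for h using Cons by auto
  then show ?case by (simp add: iterpd_Cons pd_def vector_derivative_const_at)
qed

lemma has_pd_bound:
  assumes "has_pd h b h'" "\<And>t. t \<in> {0..s} \<Longrightarrow> norm (h' (x + t *\<^sub>R b)) \<le> B" "0 \<le> s"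
  shows "norm (h (x + s *\<^sub>R b) - h x) \<le> B * s"
proof -
  have "norm (h (x + s *\<^sub>R b) - h (x + 0 *\<^sub>R b)) \<le> B * norm (s - 0)"
  proof (rule differentiable_bound[where S = "{0..s}" and f' = "\<lambda>t u. u *\<^sub>R h' (x + t *\<^sub>R b)"])
    show "((\<lambda>t. h (x + t *\<^sub>R b)) has_derivative (\<lambda>u. u *\<^sub>R h' (x + t *\<^sub>R b))) (at t within {0..s})" for t
      using has_pd_along[OF assms(1)] by (simp add: has_vector_derivative_def)
    show "onorm (\<lambda>u. u *\<^sub>R h' (x + t *\<^sub>R b)) \<le> B" if "t \<in> {0..s}" for t
      by (rule onorm_le) (use assms(2)[OF that] in \<open>auto simp: mult.commute[of B] intro!: mult_left_mono\<close>)
  qed (use assms(3) in auto)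
  then show ?thesis using assms(3) by simp
qed

text \<open>To gain one derivative in direction \<open>b\<close>, approximate \<open>pd b f\<close> and integrate the approximating polynomial
  from the face \<open>x \<bullet> b = - r\<close>, near which \<open>f\<close> vanishes.\<close>
lemma polys_dense_mset:
  fixes f :: "'a::euclidean_space \<Rightarrow> complex"
  assumes "smooth f" "tsupp f \<subseteq> open_cube r" "0 < r" "0 < e" "set L \<subseteq> Basis"
  shows "\<exists>P\<in>polys. \<forall>ws x. mset ws \<subseteq># mset L \<longrightarrow> x \<in> cube r \<longrightarrow> norm (iterpd ws (\<lambda>x. f x - P x) x) \<le> e"
  using assms(1,2,4,5)
proof (induction L arbitrary: f e)
  case Nil
  obtain P where "P \<in> polys" "\<And>x. x \<in> cube r \<Longrightarrow> norm (f x - P x) < e"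
    using polys_uniformly_dense[OF compact_cube smooth_continuous[OF Nil(1)] Nil(3)] by metis
  then show ?case by (intro bexI[of _ P]) (auto simp: less_imp_le)
next
  case (Cons b L)
  then have b: "b \<in> Basis" and L: "set L \<subseteq> Basis" by auto
  \<comment> \<open>The bound \<open>e\<close> serves words containing \<open>b\<close>;
    \<open>e / (2 * r)\<close> serves the others, which are integrated over a segment of length at
    most \<open>2 * r\<close>.\<close>
  define e' where "e' = min e (e / (2 * r))"
  have e': "0 < e'" "e' \<le> e" "e' * (2 * r) \<le> e" using Cons.prems(3) assms(3) 
    by (auto simp: e'_def min_def field_simps)
  have "tsupp (pd b f) \<subseteq> open_cube r" using tsupp_pd Cons.prems(2) by blast
  from Cons.IH[OF smooth_pd[OF Cons.prems(1) b] this e'(1) L] obtain Q where Q: "Q \<in> polys"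
    "\<And>ws x. mset ws \<subseteq># mset L \<Longrightarrow> x \<in> cube r \<Longrightarrow> norm (iterpd ws (\<lambda>x. pd b f x - Q x) x) \<le> e'" by blast
  obtain P where P: "P \<in> polys" "has_pd P b Q" "\<And>x. x \<bullet> b = - r \<Longrightarrow> P x = 0" 
    using polys_antiderivative[OF Q(1) b, of "- r"] by blast
  define g where "g = (\<lambda>x. f x - P x)"
  have g: "smooth g" unfolding g_def by (intro smooth_diff smooth_polys P Cons.prems)
  have pg: "pd b g = (\<lambda>x. pd b f x - Q x)"
    using pd_lincomb[OF Cons.prems(1) smooth_polys[OF P(1)] b, of 1 "-1"] has_pd_imp_pd[OF P(2)] by (simp add: g_def)
  have "norm (iterpd ws g x) \<le> e" if ws: "mset ws \<subseteq># mset (b # L)" and x: "x \<in> cube r" for ws x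
  proof -
    have wsB: "set ws \<subseteq> Basis" using set_mset_mono[OF ws] b L by auto
    show ?thesis
    proof (cases "b \<in> set ws")
      case True
      \<comment> \<open>A word containing \<open>b\<close> is a shorter word applied to
        \<open>pd b g = pd b f - Q\<close>, which the induction hypothesis controls.\<close>
      have "mset (remove1 b ws) \<subseteq># mset L" using ws by (simp add: subset_eq_diff_conv)
      from Q(2)[OF this x] show ?thesis
        using e'(2) unfolding iterpd_remove1[OF g wsB True] pg by linarith
    next
      case False
      then have ws': "mset ws \<subseteq># mset L" using ws 
        by (simp add: subset_eq_diff_conv[symmetric]) (metis diff_single_trivial set_mset_mset subset_eq_diff_conv add_mset_add_single)
      define h where "h = iterpd ws g"
      \<comment> \<open>\<open>y\<close> is the projection of \<open>x\<close> along
        \<open>b\<close> onto the face \<open>x \<bullet> b = - r\<close>, and \<open>s\<close> is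
        the distance travelled.\<close>
      define s where "s = x \<bullet> b + r"
      define y where "y = x - s *\<^sub>R b"
      have s: "0 \<le> s" "s \<le> 2 * r" using x b by (auto simp: s_def cube_def abs_le_iff)
      have cu: "y + t *\<^sub>R b \<in> cube r" if "t \<in> {0..s}" for t
        unfolding cube_def
      proof (intro CollectI ballI)
        fix c :: 'a assume c: "c \<in> Basis"
        show "\<bar>(y + t *\<^sub>R b) \<bullet> c\<bar> \<le> r"
          using x that c b by (cases "c = b") (auto simp: y_def s_def cube_def inner_add_left inner_diff_left inner_Basis abs_le_iff)
      qed
      have yb: "y \<bullet> b = - r" using b by (simp add: y_def s_def inner_diff_left)
      have "y \<notin> open_cube r" using b yb assms(3) by (auto simp: open_cube_def intro!: bexI[of _ b])
      then have "y \<notin> tsupp f" using Cons.prems(2) by blast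
      then have "iterpd ws f y = 0" by (rule iterpd_eq_0_off[OF closed_tsupp]) (rule not_in_tsupp)
      moreover have "iterpd ws P y = 0" by (rule iterpd_eq_0_on_face[OF b P(3) wsB False yb])
      ultimately have hy: "h y = 0" unfolding h_def g_def
        by (simp add: iterpd_diff[OF Cons.prems(1) smooth_polys[OF P(1)] wsB])
      have "pd b h = iterpd ws (\<lambda>x. pd b f x - Q x)" 
        unfolding h_def pg[symmetric] by (rule iterpd_pd_commute[OF g wsB b, symmetric])
      then have "norm (h (y + s *\<^sub>R b) - h y) \<le> e' * s"
        using has_pd_bound[OF smooth_has_pd[OF smooth_iterpd[OF g wsB] b], of s y e'] Q(2)[OF ws' cu] s
        by (simp add: h_def)
      also have "\<dots> \<le> e' * (2 * r)" using s e' by (intro mult_left_mono) auto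
      finally show ?thesis using hy e'(3) by (simp add: h_def y_def)
    qed
  qed
  then show ?case using P(1) unfolding g_def by blast
qed

text \<open>Concatenating \<open>N\<close> copies of an enumeration of \<open>Basis\<close> covers
  every word of length at most \<open>N\<close>; one list thus handles all derivatives up to order
  \<open>N\<close>.\<close>

lemma words_bounded_mset:
  "\<exists>L. set L \<subseteq> Basis \<and> (\<forall>ws\<in>words N. mset ws \<subseteq># mset (L :: 'a::euclidean_space list))"
proof (induction N)
  case 0
  then show ?case by (intro exI[of _ "[]"]) auto
next
  case (Suc N)
  then obtain L :: "'a list" where L: "set L \<subseteq> Basis" "\<forall>ws\<in>words N. mset ws \<subseteq># mset L" by auto
  obtain l :: "'a list" where l: "set l = Basis" using finite_list[OF finite_Basis] by auto
  have "mset ws \<subseteq># mset (l @ L)" if "ws \<in> words (Suc N)" for ws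
  proof (cases ws)
    case (Cons v vs)
    then have "mset vs \<subseteq># mset L" "{#v#} \<subseteq># mset l" using that L(2) l by auto
    then have "{#v#} + mset vs \<subseteq># mset l + mset L" by (intro subset_mset.add_mono)
    then show ?thesis using Cons by simp
  qed simp
  then show ?case using L(1) l by (intro exI[of _ "l @ L"]) auto
qed

lemma polys_dense:
  fixes f :: "'a::euclidean_space \<Rightarrow> complex"
  assumes "test f" "compact K" "0 < e"
  obtains P where "P \<in> polys" "small N K e (\<lambda>x. f x - P x)"
proof -
  have "compact (tsupp f \<union> K)" using assms by (intro compact_Un) (auto simp: test_def)
  then obtain r where r: "0 < r" "tsupp f \<union> K \<subseteq> open_cube r" by (rule compact_subset_open_cube)
  then have K: "K \<subseteq> cube r" using open_cube_subset_cube by blast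
  obtain L :: "'a list" where L: "set L \<subseteq> Basis" "\<forall>ws\<in>words N. mset ws \<subseteq># mset L"
    using words_bounded_mset by blast
  obtain P where "P \<in> polys" "\<And>ws x. mset ws \<subseteq># mset L \<Longrightarrow> x \<in> cube r \<Longrightarrow> norm (iterpd ws (\<lambda>x. f x - P x) x) \<le> e"
    using polys_dense_mset[OF test_smooth[OF assms(1)] _ r(1) assms(3) L(1)] r(2) by blast
  then show thesis using K L(2) by (intro that[of P]) (auto simp: small_def)
qed

section \<open>Constant-coefficient operators on the line\<close>

lemma funpow_pd_lincomb:
  assumes "smooth f" "smooth g" "v \<in> Basis"
  shows "(pd v ^^ n) (\<lambda>x. a * f x + b * g x) = (\<lambda>x. a * (pd v ^^ n) f x + b * (pd v ^^ n) g x)"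
  using assms by (induction n) (auto simp: pd_lincomb smooth_funpow_pd)

text \<open>The operator \<open>q(d/dt)\<close> on functions, without the signs of the transpose;
  those are put into the coefficients of \<open>q\<close> when it is applied to moments.\<close>

definition poly_op :: "complex poly \<Rightarrow> (real \<Rightarrow> complex) \<Rightarrow> real \<Rightarrow> complex" where
  "poly_op q f t = (\<Sum>i\<le>degree q. coeff q i * (pd 1 ^^ i) f t)"

lemma poly_op_bound:
  assumes "degree q \<le> n" shows "poly_op q f t = (\<Sum>i\<le>n. coeff q i * (pd 1 ^^ i) f t)"
  unfolding poly_op_def by (rule sum.mono_neutral_left) (use assms in \<open>auto simp: coeff_eq_0\<close>)

lemma poly_op_lincomb:
  assumes "smooth f" "smooth g"
  shows "poly_op q (\<lambda>x. a * f x + b * g x) = (\<lambda>t. a * poly_op q f t + b * poly_op q g t)"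
  unfolding poly_op_def by (rule ext) (simp add: funpow_pd_lincomb assms sum.distrib sum_distrib_left algebra_simps)

lemma test_poly_op: "test f \<Longrightarrow> test (poly_op q f)"
  unfolding poly_op_def[abs_def] by (intro test_sum test_cmult test_funpow_pd) auto

lemma funpow_pd_eq_iterpd: "(pd v ^^ n) f = iterpd (replicate n v) f"
  by (induction n) (auto simp: iterpd_Cons)

lemma tsupp_poly_op: "tsupp (poly_op q f) \<subseteq> tsupp f"
proof (rule tsupp_subset[OF closed_tsupp])
  fix t assume "t \<notin> tsupp f"
  then have "(pd 1 ^^ i) f t = 0" for i
    unfolding funpow_pd_eq_iterpd by (rule iterpd_eq_0_off[OF closed_tsupp]) (rule not_in_tsupp)
  then show "poly_op q f t = 0" by (simp add: poly_op_def)
qed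

text \<open>The factor \<open>d/dt - z\<close> acts first. Splitting off a root in this way reduces
  an operator of any order to first-order ones.\<close>

lemma poly_op_linear_factor:
  assumes f: "smooth f"
  shows "poly_op ([:- z, 1:] * r) f = poly_op r (\<lambda>t. pd 1 f t - z * f t)"
proof
  fix t
  have sm: "smooth (pd 1 f)" using f by (intro smooth_pd) auto
  have D: "(pd 1 ^^ i) (\<lambda>t. pd 1 f t - z * f t) t = (pd 1 ^^ Suc i) f t - z * (pd 1 ^^ i) f t" for i
    using funpow_pd_lincomb[OF sm f, of 1 i 1 "- z"] by (simp add: funpow_swap1)
  have "degree ([:- z, 1:] * r) \<le> Suc (degree r)"
    using degree_mult_le[of "[:- z, 1:]" r] by simp
  then have "poly_op ([:- z, 1:] * r) f t = 
      (\<Sum>i\<le>Suc (degree r). (coeff (pCons 0 r) i - z * coeff r i) * (pd 1 ^^ i) f t)"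
    by (simp add: poly_op_bound algebra_simps)
  also have "\<dots> = (\<Sum>i\<le>Suc (degree r). coeff (pCons 0 r) i * (pd 1 ^^ i) f t) 
      - z * (\<Sum>i\<le>Suc (degree r). coeff r i * (pd 1 ^^ i) f t)"
    by (simp only: left_diff_distrib sum_subtractf sum_distrib_left mult.assoc)
  also have "(\<Sum>i\<le>Suc (degree r). coeff (pCons 0 r) i * (pd 1 ^^ i) f t) = 
      (\<Sum>i\<le>degree r. coeff r i * (pd 1 ^^ Suc i) f t)"
    by (subst sum.atMost_Suc_shift) simp
  also have "(\<Sum>i\<le>Suc (degree r). coeff r i * (pd 1 ^^ i) f t) = (\<Sum>i\<le>degree r. coeff r i * (pd 1 ^^ i) f t)"
    by (simp add: coeff_eq_0)
  finally show "poly_op ([:- z, 1:] * r) f t = poly_op r (\<lambda>t. pd 1 f t - z * f t) t"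
    unfolding poly_op_def D by (simp add: algebra_simps sum_subtractf sum_distrib_left)
qed

lemma has_vector_derivative_exp_scale:
  "((\<lambda>t. exp (z * complex_of_real t)) has_vector_derivative z * exp (z * complex_of_real t)) (at t)"
proof -
  have "((\<lambda>w. exp (z * w)) has_field_derivative z * exp (z * complex_of_real t)) (at (of_real t))"
    by (auto intro!: derivative_eq_intros)
  from has_vector_derivative_real_field[OF this] show ?thesis .
qed

lemma smooth_exp: "smooth (\<lambda>t::real. exp (z * complex_of_real t))"
proof (rule smooth_coinduct[of _ "range (\<lambda>c t. c * exp (z * complex_of_real t))"])
  show "(\<lambda>t. exp (z * complex_of_real t)) \<in> range (\<lambda>c t. c * exp (z * complex_of_real t))"
    by (rule range_eqI[of _ _ 1]) simp
  show "continuous_on UNIV f" if "f \<in> range (\<lambda>c t. c * exp (z * complex_of_real t))" for f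
    using that by (auto intro!: continuous_on_mult continuous_on_exp continuous_on_const continuous_on_of_real continuous_on_id)
  show "\<exists>g\<in>range (\<lambda>c t. c * exp (z * complex_of_real t)). has_pd f v g" 
    if "f \<in> range (\<lambda>c t. c * exp (z * complex_of_real t))" "v \<in> Basis" for f v
  proof -
    from that obtain c where f: "f = (\<lambda>t. c * exp (z * complex_of_real t))" and v: "v = 1" by auto
    show ?thesis
    proof (rule bexI[of _ "\<lambda>t. (c * z) * exp (z * complex_of_real t)"])
      show "has_pd f v (\<lambda>t. (c * z) * exp (z * complex_of_real t))"
        unfolding v has_pd_real_iff f mult.assoc by (intro allI has_vector_derivative_mult_right has_vector_derivative_exp_scale)
    qed auto
  qed
qed

lemma real_test_bounded_support:
  assumes "test (f :: real \<Rightarrow> complex)"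
  obtains r where "r > 0" "\<And>t. t \<notin> {-r..r} \<Longrightarrow> f t = 0"
proof -
  from assms have "compact (tsupp f)" by (simp add: test_def)
  then obtain r where r: "r > 0" "tsupp f \<subseteq> open_cube r" by (rule compact_subset_open_cube)
  have "f t = 0" if "t \<notin> {-r..r}" for t
  proof -
    have "t \<notin> open_cube r" using that by (auto simp: open_cube_def)
    then show ?thesis using r(2) not_in_tsupp by blast
  qed
  then show thesis using r(1) that by blast
qed

text \<open>The error \<open>\<theta>\<close>, supported in \<open>t < 0\<close>, corrects the integral of \<open>exp (- z t) * f t\<close> to zero, so that the solution
  obtained by variation of constants has compact support.\<close>
lemma solve_first_order:
  fixes f :: "real \<Rightarrow> complex"
  assumes f: "test f"
  shows "\<exists>g \<theta>. test g \<and> test \<theta> \<and> tsupp \<theta> \<subseteq> {..<0} \<and> f = (\<lambda>t. (pd 1 g t - z * g t) + \<theta> t)"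
proof -
  obtain r where r: "r > 0" "\<And>t. t \<notin> {-r..r} \<Longrightarrow> f t = 0" using real_test_bounded_support[OF f] by metis
  \<comment> \<open>The integrating factor: \<open>g' - z g = f\<close> says that
    \<open>exp (- z t) * g\<close> is an antiderivative of \<open>h\<close>.\<close>
  define h where "h t = exp ((- z) * complex_of_real t) * f t" for t
  have "smooth h" unfolding h_def by (intro smooth_mult smooth_exp test_smooth f)
  moreover have "h t = 0" if "t \<notin> {-r..r}" for t using r(2)[OF that] by (simp add: h_def)
  moreover have "- r \<le> r" using r(1) by simp
  ultimately obtain F c where F: "smooth F" "\<And>t. (F has_vector_derivative h t) (at t)" 
    "\<And>t. t \<le> - r \<Longrightarrow> F t = 0" "\<And>t. t \<ge> r \<Longrightarrow> F t = c"
    using compact_support_antiderivative[of h "- r" r] by metis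
  obtain E :: "real \<Rightarrow> complex" where E: "smooth E" "\<And>t. t \<le> 0 \<Longrightarrow> E t = 0" "\<And>t. t \<ge> 1 \<Longrightarrow> E t = 1"
    using smooth_step_exists by metis
  \<comment> \<open>The shift by 2 moves the step to \<open>[-2, -1]\<close>, so its derivative, and
    with it \<theta>, is supported in \<open>t < 0\<close>.\<close>
  define E2 where "E2 t = E (1 * t + 2)" for t
  have E2: "smooth E2" unfolding E2_def by (intro smooth_affine E)
  have E2': "smooth (pd 1 E2)" using E2 by (intro smooth_pd) auto
  have dE2: "(E2 has_vector_derivative pd 1 E2 t) (at t)" for t
    using smooth_has_pd[OF E2, of 1] by (simp add: has_pd_real_iff)
  have E2z: "pd 1 E2 t = 0" if "t \<notin> {-2..-1}" for t
  proof -
    from that consider "t < -2" | "t > -1" by fastforce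
    then show ?thesis
    proof cases
      case 1
      have "pd 1 E2 t = pd 1 (\<lambda>_. 0) t" by (rule pd_cong_open[of "{..<-2}"]) (use 1 E(2) in \<open>auto simp: E2_def\<close>)
      then show ?thesis by (simp add: has_pd_imp_pd[OF has_pd_const])
    next
      case 2
      have "pd 1 E2 t = pd 1 (\<lambda>_. 1) t" by (rule pd_cong_open[of "{-1<..}"]) (use 2 E(3) in \<open>auto simp: E2_def\<close>)
      then show ?thesis by (simp add: has_pd_imp_pd[OF has_pd_const])
    qed
  qed
  define \<theta> where "\<theta> t = exp (z * complex_of_real t) * (c * pd 1 E2 t)" for t
  \<comment> \<open>To the right of both transitions \<open>F\<close> equals \<open>c\<close> and
    \<open>E2\<close> equals 1, so the difference vanishes; to the left both terms are 0.\<close>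
  define g where "g t = exp (z * complex_of_real t) * (F t - c * E2 t)" for t
  have sm: "smooth \<theta>" "smooth g" unfolding \<theta>_def g_def
    by (intro smooth_mult smooth_exp smooth_cmult smooth_diff E2 E2' F)+
  have "compact {-2..-1::real}" by simp
  then have \<theta>: "test \<theta>" "tsupp \<theta> \<subseteq> {-2..-1}"
    using testI[OF sm(1), of "{-2..-1}"] E2z by (auto simp: \<theta>_def)
  \<comment> \<open>The bound 2 is there for \<open>E2\<close>, whose transition may lie outside
    \<open>[-r, r]\<close>.\<close>
  have "g t = 0" if "t \<notin> {- max r 2..max r 2}" for t
  proof -
    from that consider "t < - max r 2" | "t > max r 2" by fastforce
    then show ?thesis
    proof cases
      case 1
      then show ?thesis using F(3)[of t] E(2)[of "t + 2"] by (auto simp: g_def E2_def)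
    next
      case 2
      then show ?thesis using F(4)[of t] E(3)[of "t + 2"] by (auto simp: g_def E2_def)
    qed
  qed
  then have g: "test g" using testI(1)[OF sm(2), of "{- max r 2..max r 2}"] by auto
  define g' where "g' t = exp (z * complex_of_real t) * (h t - c * pd 1 E2 t) + z * exp (z * complex_of_real t) * (F t - c * E2 t)" for t
  have "(g has_vector_derivative g' t) (at t)" for t
    unfolding g_def g'_def
    by (intro has_vector_derivative_mult has_vector_derivative_exp_scale has_vector_derivative_diff F 
        has_vector_derivative_mult_right dE2)
  then have "pd 1 g = g'" by (intro has_pd_imp_pd) (simp add: has_pd_real_iff)
  then have "f t = (pd 1 g t - z * g t) + \<theta> t" for t
    by (simp add: g_def g'_def \<theta>_def h_def algebra_simps exp_minus)
  then show ?thesis using g \<theta> by (intro exI[of _ g] exI[of _ \<theta>]) auto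
qed

text \<open>The dual of injectivity of \<open>q(d/dt)\<close> on distributions vanishing for
  \<open>t < 0\<close>. The roots given by the fundamental theorem of algebra are removed one by
  one.\<close>

lemma solve_poly_op:
  assumes "q \<noteq> 0" "test f"
  shows "\<exists>g \<theta>. test g \<and> test \<theta> \<and> tsupp \<theta> \<subseteq> {..<0} \<and> f = (\<lambda>t. poly_op q g t + \<theta> t)"
  using assms
proof (induction "degree q" arbitrary: q f)
  case 0
  then obtain c where q: "q = [:c:]" and c: "c \<noteq> 0" by (metis degree_eq_zeroE pCons_0_0)
  have "tsupp (\<lambda>_::real. 0) \<subseteq> {..<0}" by (simp add: tsupp_def)
  moreover have "f = (\<lambda>t. poly_op q (\<lambda>t. 1 / c * f t) t + 0)" using c by (simp add: q poly_op_def)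
  ultimately show ?case using test_cmult[OF 0(3), of "1 / c"] test_zero by blast
next
  case (Suc n)
  then have "\<not> constant (poly q)" by (simp add: constant_degree)
  then obtain z where "poly q z = 0" using fundamental_theorem_of_algebra by blast
  then obtain r where q: "q = [:- z, 1:] * r" using poly_eq_0_iff_dvd by (metis dvdE)
  then have r: "r \<noteq> 0" using Suc.prems by auto
  have "degree q = Suc (degree r)" unfolding q using r by (subst degree_mult_eq) auto
  then have "n = degree r" using Suc.hyps(2) by simp
  from Suc.hyps(1)[OF this r Suc.prems(2)] obtain g1 \<theta>1 where 1: "test g1" "test \<theta>1" "tsupp \<theta>1 \<subseteq> {..<0}" 
    "f = (\<lambda>t. poly_op r g1 t + \<theta>1 t)" by blast
  obtain g2 \<theta>2 where 2: "test g2" "test \<theta>2" "tsupp \<theta>2 \<subseteq> {..<0}" 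
    "g1 = (\<lambda>t. (pd 1 g2 t - z * g2 t) + \<theta>2 t)" using solve_first_order[OF 1(1), of z] by blast
  have sm: "smooth (\<lambda>t. pd 1 g2 t - z * g2 t)"
    using 2(1) by (intro smooth_diff smooth_cmult smooth_pd test_smooth) auto
  \<comment> \<open>The error of the first-order step reappears under \<open>r(d/dt)\<close>, which
    does not enlarge supports, so it stays in \<open>t < 0\<close>.\<close>
  have "poly_op r g1 = (\<lambda>t. poly_op q g2 t + poly_op r \<theta>2 t)"
    using poly_op_lincomb[OF sm test_smooth[OF 2(2)], of r 1 1] poly_op_linear_factor[OF test_smooth[OF 2(1)], of z r]
    unfolding 2(4) q by simp
  then have f: "f = (\<lambda>t. poly_op q g2 t + (1 * poly_op r \<theta>2 t + 1 * \<theta>1 t))" unfolding 1(4) by (simp add: add.assoc)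
  have "test (\<lambda>t. 1 * poly_op r \<theta>2 t + 1 * \<theta>1 t)" by (intro test_lincomb test_poly_op 1 2)
  moreover have "tsupp (\<lambda>t. 1 * poly_op r \<theta>2 t + 1 * \<theta>1 t) \<subseteq> tsupp \<theta>2 \<union> tsupp \<theta>1"
    using tsupp_poly_op[of r \<theta>2] by (intro tsupp_subset closed_Un closed_tsupp) (simp add: not_in_tsupp subset_iff, metis not_in_tsupp)
  ultimately show ?case using 1(3) 2(1,3) f by (intro exI[of _ g2] exI conjI) auto
qed

section \<open>Distributions and their moments\<close>

text \<open>Linearity is relative to a class \<open>T\<close> because functionals are set to 0
  outside their domain; closure of \<open>T\<close> is included so that finite sums can be handled
  once for \<open>test\<close> and \<open>smooth\<close>.\<close>

definition clinear_on :: "(('a \<Rightarrow> complex) \<Rightarrow> bool) \<Rightarrow> (('a \<Rightarrow> complex) \<Rightarrow> complex) \<Rightarrow> bool" where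
  "clinear_on T w \<longleftrightarrow> T (\<lambda>_. 0) \<and> (\<forall>f g a b. T f \<longrightarrow> T g \<longrightarrow> 
     T (\<lambda>x. a * f x + b * g x) \<and> w (\<lambda>x. a * f x + b * g x) = a * w f + b * w g)"

lemma clinear_on_lincomb: "clinear_on T w \<Longrightarrow> T f \<Longrightarrow> T g \<Longrightarrow> w (\<lambda>x. a * f x + b * g x) = a * w f + b * w g"
  by (auto simp: clinear_on_def)

lemma clinear_on_zero:
  assumes "clinear_on T w" shows "w (\<lambda>_. 0) = 0"
proof -
  have "T (\<lambda>_. 0)" using assms by (simp add: clinear_on_def)
  from clinear_on_lincomb[OF assms this this, of 0 0] show ?thesis by simp
qed

lemma clinear_on_add: "clinear_on T w \<Longrightarrow> T f \<Longrightarrow> T g \<Longrightarrow> w (\<lambda>x. f x + g x) = w f + w g"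
  using clinear_on_lincomb[of T w f g 1 1] by simp

lemma clinear_on_diff: "clinear_on T w \<Longrightarrow> T f \<Longrightarrow> T g \<Longrightarrow> w (\<lambda>x. f x - g x) = w f - w g"
  using clinear_on_lincomb[of T w f g 1 "-1"] by simp

lemma clinear_on_cmult: "clinear_on T w \<Longrightarrow> T f \<Longrightarrow> w (\<lambda>x. c * f x) = c * w f"
  using clinear_on_lincomb[of T w f f c 0] by simp

lemma clinear_on_sum:
  assumes "clinear_on T w" "finite I" "\<And>i. i \<in> I \<Longrightarrow> T (f i)"
  shows "T (\<lambda>x. \<Sum>i\<in>I. c i * f i x) \<and> w (\<lambda>x. \<Sum>i\<in>I. c i * f i x) = (\<Sum>i\<in>I. c i * w (f i))"
  using assms(2,3)
proof (induction I)
  case empty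
  then show ?case using assms(1) clinear_on_zero[OF assms(1)] by (simp add: clinear_on_def)
next
  case (insert i I)
  let ?g = "\<lambda>x. \<Sum>i\<in>I. c i * f i x"
  have "T (f i)" "T ?g" "w ?g = (\<Sum>i\<in>I. c i * w (f i))" using insert by auto
  then have "T (\<lambda>x. c i * f i x + 1 * ?g x)" "w (\<lambda>x. c i * f i x + 1 * ?g x) = c i * w (f i) + 1 * w ?g"
    using assms(1) unfolding clinear_on_def by blast+
  then show ?case using insert by simp
qed

lemma poly_op_annihilated_imp_zero:
  assumes lin: "clinear_on test w" and neg: "\<And>\<theta>. test \<theta> \<Longrightarrow> tsupp \<theta> \<subseteq> {..<0} \<Longrightarrow> w \<theta> = 0"
    and q: "q \<noteq> 0" and ann: "\<And>f. test f \<Longrightarrow> w (poly_op q f) = 0" and f: "test f"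
  shows "w f = 0"
proof -
  obtain g \<theta> where g: "test g" "test \<theta>" "tsupp \<theta> \<subseteq> {..<0}" "f = (\<lambda>t. poly_op q g t + \<theta> t)"
    using solve_poly_op[OF q f] by blast
  have "w f = w (poly_op q g) + w \<theta>" unfolding g(4) by (rule clinear_on_add[OF lin test_poly_op[OF g(1)] g(2)])
  then show ?thesis using ann[OF g(1)] neg[OF g(2,3)] by simp
qed

lemma edist_clinear: "edist v \<Longrightarrow> clinear_on smooth v"
  unfolding edist_def clinear_on_def by (auto intro: smooth_const smooth_add smooth_cmult)

lemma distribution_clinear: "distribution U \<Longrightarrow> clinear_on test U"
  unfolding distribution_def clinear_on_def by (auto intro: test_lincomb)

lemma sn_nonneg:
  assumes "smooth f" "compact K" "K \<noteq> {}"
  shows "0 \<le> sn N K f"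
proof -
  obtain x where "x \<in> K" using assms(3) by blast
  then have "norm (iterpd [] f x) \<le> sn N K f" by (intro smallD[OF small_sn[OF assms(1,2)]]) auto
  then show ?thesis using norm_ge_zero order_trans by blast
qed

lemma mult_sn_le_small:
  fixes f :: "'a::euclidean_space \<Rightarrow> complex"
  assumes "smooth f" "compact K" "K \<noteq> {}" "small N K e f"
  shows "C * sn N K f \<le> (\<bar>C\<bar> * real (card (words N :: 'a list set))) * e"
proof -
  have "C * sn N K f \<le> \<bar>C\<bar> * sn N K f" using sn_nonneg[OF assms(1-3)] by (intro mult_right_mono) auto
  also have "\<dots> \<le> \<bar>C\<bar> * (real (card (words N :: 'a list set)) * e)"
    by (intro mult_left_mono sn_le_small assms) auto
  finally show ?thesis by (simp add: mult.assoc)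
qed

text \<open>For empty \<open>K\<close> the seminorm \<open>sn N K\<close> is the constant \<open>card (words N) * Sup {}\<close>; the estimate then
  forces the functional to vanish by homogeneity.\<close>
lemma edist_small_bound:
  fixes v :: "('a::euclidean_space \<Rightarrow> complex) \<Rightarrow> complex"
  assumes "edist v"
  shows "\<exists>K C N. compact K \<and> C \<ge> 0 \<and> (\<forall>f e. smooth f \<longrightarrow> 0 \<le> e \<longrightarrow> small N K e f \<longrightarrow> norm (v f) \<le> C * e)"
proof -
  obtain K C N where K: "compact K" "\<And>f. smooth f \<Longrightarrow> norm (v f) \<le> C * sn N K f"
    using assms unfolding edist_def by blast
  show ?thesis
  proof (cases "K = {}")
    case False
    then show ?thesis
      using K order_trans[OF K(2) mult_sn_le_small[OF _ K(1) False]]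
      by (intro exI[of _ K] exI[of _ "\<bar>C\<bar> * real (card (words N :: 'a list set))"] exI[of _ N]) auto
  next
    case True
    define M where "M = C * sn N K (\<lambda>_. 0)"
    have M: "norm (v f) \<le> M" if "smooth f" for f
      using K(2)[OF that] by (simp add: M_def True sn_def)
    have "v f = 0" if f: "smooth f" for f
    proof (rule ccontr)
      assume "v f \<noteq> 0"
      \<comment> \<open>Scaled so that \<open>a * v f\<close> has norm \<open>M + 1\<close>, beyond
        the uniform bound \<open>M\<close>.\<close>
      define a where "a = (M + 1) / norm (v f)"
      have "v (\<lambda>x. of_real a * f x) = of_real a * v f" 
        by (rule clinear_on_cmult[OF edist_clinear[OF assms] f])
      then have "norm (of_real a * v f) \<le> M" using M[OF smooth_cmult[OF f]] by metis
      then have "\<bar>M + 1\<bar> \<le> M" 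
        using \<open>v f \<noteq> 0\<close> unfolding norm_mult norm_of_real a_def by (simp add: abs_divide)
      then show False by linarith
    qed
    then show ?thesis by (intro exI[of _ "{}"] exI[of _ 0]) simp
  qed
qed

lemma distribution_small_bound:
  fixes U :: "('a::euclidean_space \<Rightarrow> complex) \<Rightarrow> complex"
  assumes "distribution U" "compact K"
  shows "\<exists>C N. C \<ge> 0 \<and> (\<forall>f e. test f \<longrightarrow> tsupp f \<subseteq> K \<longrightarrow> 0 \<le> e \<longrightarrow> small N K e f \<longrightarrow> norm (U f) \<le> C * e)"
proof (cases "K = {}")
  case False
  from assms(1) have "\<forall>K. compact K \<longrightarrow> (\<exists>C N. \<forall>f. test f \<and> tsupp f \<subseteq> K \<longrightarrow> norm (U f) \<le> C * sn N K f)"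
    unfolding distribution_def by (elim conjE)
  then obtain C N where K: "\<forall>f. test f \<and> tsupp f \<subseteq> K \<longrightarrow> norm (U f) \<le> C * sn N K f"
    using assms(2) by meson
  have "norm (U f) \<le> (\<bar>C\<bar> * real (card (words N :: 'a list set))) * e" 
    if "test f" "tsupp f \<subseteq> K" "small N K e f" for f e
  proof -
    have "norm (U f) \<le> C * sn N K f" using K that by blast
    also note mult_sn_le_small[OF test_smooth[OF that(1)] assms(2) False that(3)]
    finally show ?thesis .
  qed
  then show ?thesis
    by (intro exI[of _ "\<bar>C\<bar> * real (card (words N :: 'a list set))"] exI[of _ N]) auto
next
  case True
  have "U f = 0" if "tsupp f \<subseteq> K" for f
  proof -
    have "f = (\<lambda>_. 0)" using that True not_in_tsupp by fastforce
    then show ?thesis using clinear_on_zero[OF distribution_clinear[OF assms(1)]] by simp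
  qed
  then show ?thesis by (intro exI[of _ 0]) simp
qed

text \<open>\<open>K\<close> comes from the continuity estimate. Agreement on an open neighbourhood
  makes all derivatives of \<open>f - g\<close> vanish on \<open>K\<close>, so the estimate applies
  with \<open>e = 0\<close>.\<close>

lemma edist_local:
  assumes "edist v"
  shows "\<exists>K. compact K \<and> 
    (\<forall>f g S. smooth f \<longrightarrow> smooth g \<longrightarrow> open S \<longrightarrow> K \<subseteq> S \<longrightarrow> (\<forall>x\<in>S. f x = g x) \<longrightarrow> v f = v g)"
proof -
  from edist_small_bound[OF assms] obtain K C N where K: "compact K" "C \<ge> 0"
    and "\<forall>f e. smooth f \<longrightarrow> 0 \<le> e \<longrightarrow> small N K e f \<longrightarrow> norm (v f) \<le> C * e"
    by (elim exE conjE) (rule that)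
  note bound = this(3)[rule_format]
  show ?thesis
  proof (intro exI[of _ K] conjI allI impI K(1))
    fix f g S assume f: "smooth f" and g: "smooth g" and S: "open S" "K \<subseteq> S" and eq: "\<forall>x\<in>S. f x = g x"
    have "iterpd vs (\<lambda>x. f x - g x) x = iterpd vs (\<lambda>_. 0) x" if "x \<in> K" for vs x
      by (rule iterpd_cong_open[OF S(1)]) (use that S eq in auto)
    then have "small N K 0 (\<lambda>x. f x - g x)" by (simp add: small_def)
    then have "norm (v (\<lambda>x. f x - g x)) \<le> C * 0" by (intro bound smooth_diff f g) simp
    then show "v f = v g" using clinear_on_diff[OF edist_clinear[OF assms] f g] by simp
  qed
qed

text \<open>The moments are the values on a spanning set of the polynomials, and the continuity
  estimate passes from these to \<open>f\<close> by approximation in all derivatives up to order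
  \<open>N\<close> on \<open>K\<close>.\<close>

lemma edist_zero_if_moments_zero:
  assumes v: "edist v" and m: "\<And>k. v (dmono k) = 0" and f: "test f"
  shows "v f = 0"
proof -
  from edist_small_bound[OF v] obtain K C N where K: "compact K" "C \<ge> 0"
    and "\<forall>f e. smooth f \<longrightarrow> 0 \<le> e \<longrightarrow> small N K e f \<longrightarrow> norm (v f) \<le> C * e"
    by (elim exE conjE) (rule that)
  note bound = this(3)[rule_format]
  have lin: "clinear_on smooth v" by (rule edist_clinear[OF v])
  have P0: "v P = 0" if "P \<in> polys" for P
    using that
    by induction (auto simp: m clinear_on_add[OF lin] clinear_on_cmult[OF lin] smooth_polys)
  have "norm (v f) \<le> C * e" if e: "0 < e" for e
  proof -
    obtain P where P: "P \<in> polys" "small N K e (\<lambda>x. f x - P x)" by (rule polys_dense[OF f K(1) e])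
    have "v (\<lambda>x. f x - P x) = v f" using clinear_on_diff[OF lin test_smooth[OF f] smooth_polys[OF P(1)]] P0[OF P(1)] by simp
    then show ?thesis using bound[OF smooth_diff[OF test_smooth[OF f] smooth_polys[OF P(1)]] _ P(2)] e by simp
  qed
  then have *: "norm (v f) \<le> C * e" if "0 < e" for e using that .
  have "norm (v f) \<le> 0 + e" if "0 < e" for e 
    using *[of "e / C"] *[of 1] that K(2) by (cases "C = 0") auto
  then show ?thesis using field_le_epsilon[of "norm (v f)" 0] by auto
qed

text \<open>With \<open>w i = k ^ h i\<close> for an injective \<open>h\<close>, equal weights make \<open>k\<close> a root of one of finitely many non-zero polynomials.\<close>
lemma separating_weight_exists:
  fixes B :: "('d::finite \<Rightarrow> nat) set"
  assumes "finite B"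
  obtains w :: "'d \<Rightarrow> nat" where "inj_on (\<lambda>\<beta>. \<Sum>i\<in>UNIV. w i * \<beta> i) B"
proof -
  obtain h :: "'d \<Rightarrow> nat" where h: "inj h" using finite_imp_inj_to_nat_seg[of "UNIV :: 'd set"] by auto
  define P where "P \<beta> \<beta>' = (\<Sum>i\<in>UNIV. monom (real (\<beta> i) - real (\<beta>' i)) (h i))" for \<beta> \<beta>' :: "'d \<Rightarrow> nat"
  have P: "P \<beta> \<beta>' \<noteq> 0" if "\<beta> \<noteq> \<beta>'" for \<beta> \<beta>'
  proof
    assume 0: "P \<beta> \<beta>' = 0"
    have "real (\<beta> j) - real (\<beta>' j) = 0" for j
    proof -
      have "coeff (P \<beta> \<beta>') (h j) = (\<Sum>i\<in>UNIV. if i = j then real (\<beta> i) - real (\<beta>' i) else 0)"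
        unfolding P_def coeff_sum coeff_monom by (intro sum.cong) (auto simp: inj_eq[OF h])
      then show ?thesis using 0 by simp
    qed
    then show False using that by auto
  qed
  define bad where "bad = (\<Union>\<beta>\<in>B. \<Union>\<beta>'\<in>B - {\<beta>}. {x. poly (P \<beta> \<beta>') x = 0})"
  have "finite bad" unfolding bad_def using assms P by (auto intro!: poly_roots_finite)
  then have "finite (real -` bad)" by (intro finite_vimageI) (auto simp: inj_on_def)
  then obtain k where k: "real k \<notin> bad" using ex_new_if_finite[OF infinite_UNIV_nat] by blast
  have "\<beta> = \<beta>'" if "\<beta> \<in> B" "\<beta>' \<in> B" and eq: "(\<Sum>i\<in>UNIV. k ^ h i * \<beta> i) = (\<Sum>i\<in>UNIV. k ^ h i * \<beta>' i)" for \<beta> \<beta>'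
  proof (rule ccontr)
    assume "\<beta> \<noteq> \<beta>'"
    have "poly (P \<beta> \<beta>') (real k) = real (\<Sum>i\<in>UNIV. k ^ h i * \<beta> i) - real (\<Sum>i\<in>UNIV. k ^ h i * \<beta>' i)"
      by (simp add: P_def poly_sum poly_monom sum_subtractf[symmetric] algebra_simps)
    then show False using k that \<open>\<beta> \<noteq> \<beta>'\<close> by (auto simp: bad_def)
  qed
  then show thesis using that[of "\<lambda>i. k ^ h i"] by (auto simp: inj_on_def)
qed

section \<open>Tensor products, and derivatives of monomials in \<open>x\<close>\<close>

lemma smooth_tensor:
  fixes \<psi> :: "'a::euclidean_space \<Rightarrow> complex"
  assumes "smooth \<phi>" "smooth \<psi>"
  shows "smooth (\<lambda>(x, t::real). \<phi> t * \<psi> x)"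
  unfolding case_prod_unfold by (intro smooth_mult smooth_fst smooth_snd assms)

lemma test_tensor:
  fixes \<psi> :: "'a::euclidean_space \<Rightarrow> complex"
  assumes "test \<phi>" "test \<psi>"
  shows "test (\<lambda>(x, t::real). \<phi> t * \<psi> x)" "tsupp (\<lambda>(x, t). \<phi> t * \<psi> x) \<subseteq> tsupp \<psi> \<times> tsupp \<phi>"
proof -
  have "compact (tsupp \<psi> \<times> tsupp \<phi>)" using assms by (intro compact_Times) (auto simp: test_def)
  moreover have "(\<lambda>(x, t). \<phi> t * \<psi> x) z = 0" if "z \<notin> tsupp \<psi> \<times> tsupp \<phi>" for z
    using that by (cases z) (auto simp: not_in_tsupp)
  ultimately show "test (\<lambda>(x, t::real). \<phi> t * \<psi> x)" "tsupp (\<lambda>(x, t). \<phi> t * \<psi> x) \<subseteq> tsupp \<psi> \<times> tsupp \<phi>"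
    using testI[OF smooth_tensor[OF test_smooth[OF assms(1)] test_smooth[OF assms(2)]]] by blast+
qed

lemma pd_tensor_fst:
  fixes \<psi> :: "'a::euclidean_space \<Rightarrow> complex" and \<phi> :: "real \<Rightarrow> complex"
  assumes "smooth \<psi>" "v \<in> Basis"
  shows "pd (v, 0) (\<lambda>(x, t). \<phi> t * \<psi> x) = (\<lambda>(x, t). \<phi> t * pd v \<psi> x)"
proof -
  have 1: "has_pd (\<lambda>z::'a \<times> real. \<phi> (snd z)) (v, 0) (\<lambda>z. 0)"
    using has_pd_comp_linear[OF linear_snd, of \<phi> "(v, 0)" "\<lambda>_. 0"] by (simp add: has_pd_def)
  have 2: "has_pd (\<lambda>z::'a \<times> real. \<psi> (fst z)) (v, 0) (\<lambda>z. pd v \<psi> (fst z))"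
    using has_pd_comp_linear[OF linear_fst, of \<psi> "(v, 0)" "pd v \<psi>"] smooth_has_pd[OF assms] by simp
  show ?thesis using has_pd_imp_pd[OF has_pd_mult[OF 1 2]] by (simp add: case_prod_unfold)
qed

lemma pd_tensor_snd:
  fixes \<psi> :: "'a::euclidean_space \<Rightarrow> complex" and \<phi> :: "real \<Rightarrow> complex"
  assumes "smooth \<phi>"
  shows "pd (0, 1) (\<lambda>(x, t). \<phi> t * \<psi> x) = (\<lambda>(x, t). pd 1 \<phi> t * \<psi> x)"
proof -
  have 1: "has_pd (\<lambda>z::'a \<times> real. \<psi> (fst z)) (0, 1) (\<lambda>z. 0)"
    using has_pd_comp_linear[OF linear_fst, of \<psi> "(0, 1)" "\<lambda>_. 0"] by (simp add: has_pd_def)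
  have 2: "has_pd (\<lambda>z::'a \<times> real. \<phi> (snd z)) (0, 1) (\<lambda>z. pd 1 \<phi> (snd z))"
    using has_pd_comp_linear[OF linear_snd, of \<phi> "(0, 1)" "pd 1 \<phi>"] smooth_has_pd[OF assms, of 1] by simp
  show ?thesis using has_pd_imp_pd[OF has_pd_mult[OF 2 1]] by (simp add: case_prod_unfold)
qed

lemma axis_1_in_Basis [simp]: "axis i (1::real) \<in> (Basis :: (real^'d::finite) set)"
  by (simp add: axis_in_Basis_iff)

text \<open>The spatial part of \<open>Dmono\<close> on functions of \<open>x\<close> alone, with
  the enumeration of the variables as a parameter in place of the chosen list.\<close>

definition space_deriv :: "'d::finite list \<Rightarrow> ('d \<Rightarrow> nat) \<Rightarrow> (real^'d \<Rightarrow> complex) \<Rightarrow> real^'d \<Rightarrow> complex" where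
  "space_deriv l \<beta> f = foldr (\<lambda>i g. (pd (axis i 1) ^^ \<beta> i) g) l f"

lemma space_deriv_eq_iterpd: 
  fixes f :: "real^'d::finite \<Rightarrow> complex"
  shows   "space_deriv l \<beta> f = iterpd (concat (map (\<lambda>i. replicate (\<beta> i) (axis i 1)) l)) f"
proof (induction l)
  case (Cons i l)
  have "iterpd (replicate n v @ vs) f = (pd v ^^ n) (iterpd vs f)" for n vs and v :: "real^'d"
    by (induction n) (auto simp: iterpd_Cons)
  then show ?case using Cons by (simp add: space_deriv_def)
qed (simp add: space_deriv_def)

lemma smooth_space_deriv: "smooth f \<Longrightarrow> smooth (space_deriv l \<beta> f)"
  unfolding space_deriv_eq_iterpd by (intro smooth_iterpd) auto

lemma test_space_deriv: "test f \<Longrightarrow> test (space_deriv l \<beta> f)"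
  by (rule testI(1)[OF smooth_space_deriv, of f "tsupp f"])
    (auto simp: test_def space_deriv_eq_iterpd intro: iterpd_eq_0_off[OF closed_tsupp] not_in_tsupp)

lemma funpow_pd_tensor_fst:
  fixes \<phi> :: "real \<Rightarrow> complex" and \<psi> :: "real^'d::finite \<Rightarrow> complex"
  assumes "smooth \<psi>"
  shows "(pd (axis i 1, 0) ^^ n) (\<lambda>(x, t). \<phi> t * \<psi> x) = (\<lambda>(x, t). \<phi> t * (pd (axis i 1) ^^ n) \<psi> x)"
  by (induction n) (simp_all add: pd_tensor_fst smooth_funpow_pd assms)

lemma funpow_pd_tensor_snd:
  fixes \<phi> :: "real \<Rightarrow> complex" and \<psi> :: "'a::euclidean_space \<Rightarrow> complex"
  assumes "smooth \<phi>"
  shows "(pd (0, 1) ^^ n) (\<lambda>(x, t). \<phi> t * \<psi> x) = (\<lambda>(x, t). (pd 1 ^^ n) \<phi> t * \<psi> x)"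
  by (induction n) (simp_all add: pd_tensor_snd smooth_funpow_pd assms)

lemma foldr_pd_tensor:
  fixes \<phi> :: "real \<Rightarrow> complex" and \<psi> :: "real^'d::finite \<Rightarrow> complex"
  assumes "smooth \<psi>"
  shows "foldr (\<lambda>i g. (pd (axis i 1, 0) ^^ \<beta> i) g) l (\<lambda>(x, t). \<phi> t * \<psi> x) = 
    (\<lambda>(x, t). \<phi> t * space_deriv l \<beta> \<psi> x)"
proof (induction l)
  case (Cons i l)
  then show ?case using funpow_pd_tensor_fst[OF smooth_space_deriv[OF assms]] by (simp add: space_deriv_def)
qed (simp add: space_deriv_def)

lemma Dmono_tensor:
  fixes m :: "'d::finite option \<Rightarrow>\<^sub>0 nat"
  assumes "smooth \<phi>" "smooth \<psi>"
  shows "Dmono m (\<lambda>(x, t). \<phi> t * \<psi> x) = (\<lambda>(x, t). (pd 1 ^^ Poly_Mapping.lookup m None) \<phi> t * 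
    space_deriv (SOME l. distinct l \<and> set l = UNIV) (\<lambda>i. Poly_Mapping.lookup m (Some i)) \<psi> x)"
  unfolding Dmono_def foldr_pd_tensor[OF assms(2)] by (rule funpow_pd_tensor_snd[OF assms(1)])

text \<open>The monomial \<open>x\<^sup>\<alpha> / \<alpha>!\<close>; \<open>dmono\<close> only looks at its exponents on \<open>Basis\<close>, where \<open>THE\<close> is well defined.\<close>
definition xmono :: "('d::finite \<Rightarrow> nat) \<Rightarrow> real^'d \<Rightarrow> complex" where
  "xmono \<alpha> = dmono (\<lambda>b. \<alpha> (THE i. b = axis i 1))"

lemma dmono_cong: "(\<And>b. b \<in> Basis \<Longrightarrow> k b = l b) \<Longrightarrow> dmono k = dmono l"
  unfolding dmono_def by (intro ext prod.cong) auto

lemma the_axis [simp]: "(THE i. axis j (1::real) = axis i 1) = j"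
  by (auto simp: axis_eq_axis)

lemma dmono_eq_xmono: "dmono k = xmono (\<lambda>i. k (axis i 1))"
  unfolding xmono_def by (rule dmono_cong) (auto simp: Basis_vec_def)

lemma smooth_xmono: "smooth (xmono \<alpha>)"
  by (simp add: xmono_def smooth_dmono)

lemma pd_xmono: "pd (axis i 1) (xmono \<alpha>) = (if \<alpha> i = 0 then (\<lambda>_. 0) else xmono (\<alpha>(i := \<alpha> i - 1)))"
proof -
  have "dmono ((\<lambda>b. \<alpha> (THE i. b = axis i 1))(axis i 1 := \<alpha> i - 1)) = xmono (\<alpha>(i := \<alpha> i - 1))"
    unfolding xmono_def by (rule dmono_cong) (auto simp: Basis_vec_def axis_eq_axis)
  then show ?thesis unfolding xmono_def[of \<alpha>] by (simp add: pd_dmono)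
qed

lemma funpow_pd_zero: "(pd v ^^ n) (\<lambda>_. 0) = (\<lambda>_. 0)"
  unfolding funpow_pd_eq_iterpd by (rule iterpd_zero)

lemma funpow_pd_xmono: 
  "(pd (axis i 1) ^^ n) (xmono \<alpha>) = (if n \<le> \<alpha> i then xmono (\<alpha>(i := \<alpha> i - n)) else (\<lambda>_. 0))"
proof (induction n arbitrary: \<alpha>)
  case (Suc n)
  show ?case
  proof (cases "\<alpha> i")
    case 0
    then show ?thesis by (simp only: funpow_Suc_right o_def pd_xmono) (simp add: funpow_pd_zero)
  next
    case (Suc k)
    then show ?thesis using Suc.IH by (simp only: funpow_Suc_right o_def pd_xmono) (auto simp: fun_eq_iff intro!: arg_cong[where f = xmono])
  qed
qed simp

text \<open>Distinctness lowers each exponent by \<open>\<beta> i\<close> just once. The guard rules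
  out truncated subtraction: if some exponent is too small, the derivative is zero.\<close>

lemma space_deriv_xmono:
  assumes "distinct l"
  shows "space_deriv l \<beta> (xmono \<gamma>) = 
    (if \<forall>i\<in>set l. \<beta> i \<le> \<gamma> i then xmono (\<lambda>i. if i \<in> set l then \<gamma> i - \<beta> i else \<gamma> i) else (\<lambda>_. 0))"
  using assms
proof (induction l)
  case (Cons i l)
  define \<gamma>' where "\<gamma>' = (\<lambda>i. if i \<in> set l then \<gamma> i - \<beta> i else \<gamma> i)"
  have i: "\<gamma>' i = \<gamma> i" using Cons.prems by (simp add: \<gamma>'_def)
  have eq: "\<gamma>'(i := \<gamma> i - \<beta> i) = (\<lambda>j. if j \<in> set (i # l) then \<gamma> j - \<beta> j else \<gamma> j)"
    by (auto simp: \<gamma>'_def fun_eq_iff)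
  have "space_deriv (i # l) \<beta> (xmono \<gamma>) = (pd (axis i 1) ^^ \<beta> i) (space_deriv l \<beta> (xmono \<gamma>))"
    by (simp add: space_deriv_def)
  also have "\<dots> = (if \<forall>j\<in>set l. \<beta> j \<le> \<gamma> j then (pd (axis i 1) ^^ \<beta> i) (xmono \<gamma>') else (\<lambda>_. 0))"
    using Cons by (simp add: \<gamma>'_def funpow_pd_zero)
  also have "\<dots> = (if \<forall>j\<in>set (i # l). \<beta> j \<le> \<gamma> j then xmono (\<gamma>'(i := \<gamma> i - \<beta> i)) else (\<lambda>_. 0))"
    by (simp add: funpow_pd_xmono i)
  finally show ?case unfolding eq .
qed (simp add: space_deriv_def)

section \<open>The moments and their vanishing\<close>

lemma Lmap_edist: "Lmap u \<Longrightarrow> test \<phi> \<Longrightarrow> edist (u \<phi>)"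
  by (simp add: Lmap_def)

text \<open>With \<psi> a monomial this is a moment as a functional on test functions of
  \<open>t\<close>, the object to which one-variable injectivity is applied.\<close>

lemma Lmap_clinear: "Lmap u \<Longrightarrow> clinear_on test (\<lambda>\<phi>. u \<phi> \<psi>)"
  unfolding Lmap_def clinear_on_def by (auto intro: test_lincomb)

text \<open>Testing \<open>D\<^sub>p U = 0\<close> against \<open>\<phi> \<otimes> \<rho> x\<^sup>\<gamma> / \<gamma>!\<close>, with a cutoff \<open>\<rho>\<close> that is invisible to the compactly
  supported distributions \<open>u (\<phi>\<^sup>(\<^sup>j\<^sup>))\<close>, gives the relations between the moments of \<open>u\<close>.\<close>
lemma moment_relation:
  fixes p :: "('d::finite option \<Rightarrow>\<^sub>0 nat) \<Rightarrow>\<^sub>0 complex"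
  assumes U: "distribution U" and u: "Lmap u"
    and agree: "\<And>\<phi> \<psi>. test \<phi> \<Longrightarrow> test \<psi> \<Longrightarrow> U (\<lambda>(x, t). \<phi> t * \<psi> x) = u \<phi> \<psi>"
    and D: "Dp p U = (\<lambda>_. 0)" and \<phi>: "test \<phi>"
  shows "(\<Sum>m\<in>Poly_Mapping.keys p. (Poly_Mapping.lookup p m * (-1) ^ (\<Sum>v\<in>Poly_Mapping.keys m. Poly_Mapping.lookup m v)) *
    (if \<forall>i. Poly_Mapping.lookup m (Some i) \<le> \<gamma> i 
     then u ((pd 1 ^^ Poly_Mapping.lookup m None) \<phi>) (xmono (\<lambda>i. \<gamma> i - Poly_Mapping.lookup m (Some i))) else 0)) = 0"
proof -
  \<comment> \<open>The very list chosen inside \<open>Dmono\<close>, so that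
    \<open>Dmono_tensor\<close> applies.\<close>
  define L :: "'d list" where "L = (SOME l. distinct l \<and> set l = UNIV)"
  have L: "distinct L" "set L = UNIV"
    using someI_ex[of "\<lambda>l::'d list. distinct l \<and> set l = UNIV"] finite_distinct_list[of "UNIV :: 'd set"] 
    unfolding L_def by auto
  define c where "c m = Poly_Mapping.lookup p m * (-1) ^ (\<Sum>v\<in>Poly_Mapping.keys m. Poly_Mapping.lookup m v)" for m
  define \<beta> where "\<beta> m i = Poly_Mapping.lookup m (Some i)" for m :: "'d option \<Rightarrow>\<^sub>0 nat" and i
  define \<Phi> where "\<Phi> m = (pd 1 ^^ Poly_Mapping.lookup m None) \<phi>" for m :: "'d option \<Rightarrow>\<^sub>0 nat"
  have \<Phi>: "test (\<Phi> m)" for m unfolding \<Phi>_def using \<phi> by (intro test_funpow_pd) auto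
  have "\<forall>m. \<exists>K. compact K \<and> (\<forall>f g S. smooth f \<longrightarrow> smooth g \<longrightarrow> open S \<longrightarrow> K \<subseteq> S \<longrightarrow> (\<forall>x\<in>S. f x = g x) \<longrightarrow> u (\<Phi> m) f = u (\<Phi> m) g)"
    by (intro allI edist_local Lmap_edist[OF u] \<Phi>)
  then obtain K where K: "\<And>m. compact (K m)" 
    "\<And>m f g S. smooth f \<Longrightarrow> smooth g \<Longrightarrow> open S \<Longrightarrow> K m \<subseteq> S \<Longrightarrow> (\<forall>x\<in>S. f x = g x) \<Longrightarrow> u (\<Phi> m) f = u (\<Phi> m) g"
    unfolding choice_iff by blast
  \<comment> \<open>Only finitely many functionals \<open>u (\<Phi> m)\<close> occur, so one cutoff
    serves all of them.\<close>
  have "compact (\<Union>m\<in>Poly_Mapping.keys p. K m)" using K(1) by (intro compact_UN) auto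
  then obtain \<rho> S where \<rho>: "test \<rho>" "open S" "(\<Union>m\<in>Poly_Mapping.keys p. K m) \<subseteq> S" "\<And>x. x \<in> S \<Longrightarrow> \<rho> x = 1"
    using cutoff_on_compact by metis
  define \<psi> where "\<psi> x = xmono \<gamma> x * \<rho> x" for x
  have \<psi>: "test \<psi>" unfolding \<psi>_def by (intro test_mult smooth_xmono \<rho>)
  have loc: "u (\<Phi> m) (space_deriv L (\<beta> m) \<psi>) = (if \<forall>i. \<beta> m i \<le> \<gamma> i then u (\<Phi> m) (xmono (\<lambda>i. \<gamma> i - \<beta> m i)) else 0)"
    if m: "m \<in> Poly_Mapping.keys p" for m
  proof -
    have "u (\<Phi> m) (space_deriv L (\<beta> m) \<psi>) = u (\<Phi> m) (space_deriv L (\<beta> m) (xmono \<gamma>))"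
    proof (rule K(2)[OF _ _ \<rho>(2)])
      show "\<forall>x\<in>S. space_deriv L (\<beta> m) \<psi> x = space_deriv L (\<beta> m) (xmono \<gamma>) x"
        unfolding space_deriv_eq_iterpd using \<rho>(4) 
        by (intro ballI iterpd_cong_open[OF \<rho>(2)]) (auto simp: \<psi>_def)
    qed (use \<rho>(3) m in \<open>auto intro!: smooth_space_deriv smooth_xmono test_smooth[OF \<psi>]\<close>)
    then show ?thesis 
      using clinear_on_zero[OF edist_clinear[OF Lmap_edist[OF u \<Phi>[of m]]]]
      by (simp add: space_deriv_xmono[OF L(1)] L(2))
  qed
  define f where "f = (\<lambda>(x, t). \<phi> t * \<psi> x)"
  have f: "test f" unfolding f_def by (rule test_tensor(1)[OF \<phi> \<psi>])
  define F where "F m = (\<lambda>(x, t). \<Phi> m t * space_deriv L (\<beta> m) \<psi> x)" for m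
  have F: "test (F m)" for m unfolding F_def by (intro test_tensor(1) \<Phi> test_space_deriv \<psi>)
  have "Dmono m f = F m" for m
    unfolding f_def F_def \<Phi>_def \<beta>_def L_def by (rule Dmono_tensor[OF test_smooth[OF \<phi>] test_smooth[OF \<psi>]])
  then have dop: "dop_t p f = (\<lambda>z. \<Sum>m\<in>Poly_Mapping.keys p. c m * F m z)" by (simp add: dop_t_def c_def)
  have "0 = Dp p U f" by (simp add: D)
  also have "\<dots> = U (\<lambda>z. \<Sum>m\<in>Poly_Mapping.keys p. c m * F m z)" using f by (simp add: Dp_def dop)
  also have "\<dots> = (\<Sum>m\<in>Poly_Mapping.keys p. c m * U (F m))"
    using clinear_on_sum[OF distribution_clinear[OF U], of "Poly_Mapping.keys p" F c] F by simp
  also have "\<dots> = (\<Sum>m\<in>Poly_Mapping.keys p. c m * u (\<Phi> m) (space_deriv L (\<beta> m) \<psi>))"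
    unfolding F_def by (intro sum.cong refl arg_cong2[where f = "(*)"] agree \<Phi> test_space_deriv \<psi>)
  also have "\<dots> = (\<Sum>m\<in>Poly_Mapping.keys p. c m * (if \<forall>i. \<beta> m i \<le> \<gamma> i then u (\<Phi> m) (xmono (\<lambda>i. \<gamma> i - \<beta> m i)) else 0))"
    by (intro sum.cong refl arg_cong2[where f = "(*)"] loc)
  finally show ?thesis unfolding c_def \<beta>_def \<Phi>_def by (rule sym)
qed

lemma moment_zero:
  fixes p :: "('d::finite option \<Rightarrow>\<^sub>0 nat) \<Rightarrow>\<^sub>0 complex"
  assumes p: "p \<noteq> 0" and U: "distribution U" and u: "Lmap u"
    and agree: "\<And>\<phi> \<psi>. test \<phi> \<Longrightarrow> test \<psi> \<Longrightarrow> U (\<lambda>(x, t). \<phi> t * \<psi> x) = u \<phi> \<psi>"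
    and D: "Dp p U = (\<lambda>_. 0)" and neg: "vanishes_neg U" and \<phi>: "test \<phi>"
  shows "u \<phi> (xmono \<alpha>) = 0"
proof -
  define c where "c m = Poly_Mapping.lookup p m * (-1) ^ (\<Sum>v\<in>Poly_Mapping.keys m. Poly_Mapping.lookup m v)" for m
  define \<beta> where "\<beta> m i = Poly_Mapping.lookup m (Some i)" for m :: "'d option \<Rightarrow>\<^sub>0 nat" and i
  define j where "j m = Poly_Mapping.lookup m None" for m :: "'d option \<Rightarrow>\<^sub>0 nat"
  define keys where "keys = Poly_Mapping.keys p"
  have keys: "finite keys" "keys \<noteq> {}" using p by (auto simp: keys_def)
  obtain w :: "'d \<Rightarrow> nat" where w: "inj_on (\<lambda>\<beta>. \<Sum>i\<in>UNIV. w i * \<beta> i) (\<beta> ` keys)"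
    using separating_weight_exists[of "\<beta> ` keys"] keys(1) by blast
  define W where "W \<beta> = (\<Sum>i\<in>UNIV. w i * \<beta> i)" for \<beta> :: "'d \<Rightarrow> nat"
  obtain m0 where m0: "m0 \<in> keys" "\<And>m. m \<in> keys \<Longrightarrow> W (\<beta> m0) \<le> W (\<beta> m)"
    using ex_min_if_finite[of "(\<lambda>m. W (\<beta> m)) ` keys"] keys by (metis (no_types, lifting) arg_min_if_finite(1) arg_min_least)
  define \<beta>0 where "\<beta>0 = \<beta> m0"
  have lt: "W \<beta>0 < W (\<beta> m)" if "m \<in> keys" "\<beta> m \<noteq> \<beta>0" for m
    using m0(2)[OF that(1)] inj_onD[OF w, of "\<beta> m" \<beta>0] that m0(1) by (force simp: W_def \<beta>0_def)
  define B where "B = {m \<in> keys. \<beta> m = \<beta>0}"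
  have B: "finite B" "m0 \<in> B" using keys m0 by (auto simp: B_def \<beta>0_def)
  \<comment> \<open>Inside \<open>B\<close> the spatial exponents agree, so a monomial is determined
    by its exponent of \<open>T\<close>; hence the terms of \<open>q\<close> cannot cancel and
    \<open>q \<noteq> 0\<close>.\<close>
  have injj: "inj_on j B"
  proof (rule inj_onI)
    fix m m' assume *: "m \<in> B" "m' \<in> B" "j m = j m'"
    have "Poly_Mapping.lookup m v = Poly_Mapping.lookup m' v" for v
    proof (cases v)
      case None then show ?thesis using * by (simp add: j_def)
    next
      case (Some i)
      have "\<beta> m i = \<beta> m' i" using * by (simp add: B_def)
      then show ?thesis using Some by (simp add: \<beta>_def)
    qed
    then show "m = m'" by (rule poly_mapping_eqI)
  qed
  define q where "q = (\<Sum>m\<in>B. monom (c m) (j m))"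
  have "coeff q (j m0) = (\<Sum>m\<in>B. if m = m0 then c m else 0)"
    unfolding q_def coeff_sum coeff_monom by (intro sum.cong) (use injj B in \<open>auto simp: inj_on_eq_iff\<close>)
  then have "coeff q (j m0) = c m0" using B by simp
  moreover have "c m0 \<noteq> 0" using m0(1) by (simp add: c_def keys_def in_keys_iff)
  ultimately have q: "q \<noteq> 0" by auto
  have q_op: "poly_op q f t = (\<Sum>m\<in>B. c m * (pd 1 ^^ j m) f t)" for f t
  proof -
    \<comment> \<open>Enlarging the range by the sum of all \<open>j m\<close> puts every exponent
      of \<open>B\<close> inside it, so that each inner sum picks out its one term.\<close>
    have "poly_op q f t = (\<Sum>i\<le>degree q + (\<Sum>m\<in>B. j m). (\<Sum>m\<in>B. if i = j m then c m * (pd 1 ^^ i) f t else 0))"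
      unfolding poly_op_bound[of q "degree q + (\<Sum>m\<in>B. j m)", simplified]
      by (intro sum.cong) (auto simp: q_def coeff_sum coeff_monom sum_distrib_right intro!: sum.cong)
    also have "\<dots> = (\<Sum>m\<in>B. \<Sum>i\<le>degree q + (\<Sum>m\<in>B. j m). if i = j m then c m * (pd 1 ^^ i) f t else 0)"
      by (rule sum.swap)
    also have "\<dots> = (\<Sum>m\<in>B. c m * (pd 1 ^^ j m) f t)"
    proof (intro sum.cong refl)
      fix m assume "m \<in> B"
      then have "j m \<le> degree q + (\<Sum>m\<in>B. j m)" using member_le_sum[of m B j] B(1) by auto
      then show "(\<Sum>i\<le>degree q + (\<Sum>m\<in>B. j m). if i = j m then c m * (pd 1 ^^ i) f t else 0) = c m * (pd 1 ^^ j m) f t"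
        by simp
    qed
    finally show ?thesis .
  qed
  have "\<forall>f. test f \<longrightarrow> u f (xmono \<alpha>) = 0"
  proof (induction "W \<alpha>" arbitrary: \<alpha> rule: less_induct)
    case less
    \<comment> \<open>This choice makes the terms with spatial exponent \<open>\<beta>0\<close>
      produce the moment \<alpha>.\<close>
    define \<gamma> where "\<gamma> i = \<alpha> i + \<beta>0 i" for i
    have ann: "u (poly_op q f) (xmono \<alpha>) = 0" if f: "test f" for f
    proof -
      have trm: "(if \<forall>i. \<beta> m i \<le> \<gamma> i then u ((pd 1 ^^ j m) f) (xmono (\<lambda>i. \<gamma> i - \<beta> m i)) else 0) =
         (if m \<in> B then u ((pd 1 ^^ j m) f) (xmono \<alpha>) else 0)" if m: "m \<in> keys" for m
      proof (cases "m \<in> B")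
        case True
        then have "\<beta> m = \<beta>0" by (simp add: B_def)
        then show ?thesis using True by (simp add: \<gamma>_def)
      next
        case False
        then have "\<beta> m \<noteq> \<beta>0" using m by (simp add: B_def)
        have "u ((pd 1 ^^ j m) f) (xmono (\<lambda>i. \<gamma> i - \<beta> m i)) = 0" if le: "\<forall>i. \<beta> m i \<le> \<gamma> i"
        proof -
          \<comment> \<open>Weights are stated as a sum because subtraction on \<open>nat\<close> is
            truncated; the guard \<open>le\<close> makes \<gamma> split exactly.\<close>
          have "W (\<lambda>i. \<gamma> i - \<beta> m i) + W (\<beta> m) = W \<alpha> + W \<beta>0"
            unfolding W_def sum.distrib[symmetric] using le
            by (intro sum.cong refl) (simp add: distrib_left[symmetric] \<gamma>_def)
          then have "W (\<lambda>i. \<gamma> i - \<beta> m i) < W \<alpha>" using lt[OF m \<open>\<beta> m \<noteq> \<beta>0\<close>] by linarith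
          moreover have "test ((pd 1 ^^ j m) f)" using f by (intro test_funpow_pd) auto
          ultimately show ?thesis using less by blast
        qed
        then show ?thesis using False by simp
      qed
      have tf: "test ((pd 1 ^^ j m) f)" for m using f by (intro test_funpow_pd) auto
      have "0 = (\<Sum>m\<in>keys. c m * (if \<forall>i. \<beta> m i \<le> \<gamma> i then u ((pd 1 ^^ j m) f) (xmono (\<lambda>i. \<gamma> i - \<beta> m i)) else 0))"
        unfolding c_def keys_def \<beta>_def j_def using moment_relation[OF U u agree D f, of \<gamma>] by simp
      also have "\<dots> = (\<Sum>m\<in>keys. if m \<in> B then c m * u ((pd 1 ^^ j m) f) (xmono \<alpha>) else 0)"
        by (intro sum.cong refl) (subst trm, auto)
      also have "\<dots> = (\<Sum>m\<in>B. c m * u ((pd 1 ^^ j m) f) (xmono \<alpha>))"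
        by (rule sum.mono_neutral_cong_right) (use keys in \<open>auto simp: B_def\<close>)
      also have "\<dots> = u (\<lambda>t. \<Sum>m\<in>B. c m * (pd 1 ^^ j m) f t) (xmono \<alpha>)"
        using clinear_on_sum[OF Lmap_clinear[OF u, of "xmono \<alpha>"] B(1), of "\<lambda>m. (pd 1 ^^ j m) f" c] tf by simp
      also have "(\<lambda>t. \<Sum>m\<in>B. c m * (pd 1 ^^ j m) f t) = poly_op q f" using q_op by (simp add: fun_eq_iff)
      finally show ?thesis by simp
    qed
    have "u \<theta> (xmono \<alpha>) = 0" if \<theta>: "test \<theta>" "tsupp \<theta> \<subseteq> {..<0}" for \<theta>
    proof -
      from edist_local[OF Lmap_edist[OF u \<theta>(1)]] obtain K where K: "compact K" 
        "\<forall>f g S. smooth f \<longrightarrow> smooth g \<longrightarrow> open S \<longrightarrow> K \<subseteq> S \<longrightarrow> (\<forall>x\<in>S. f x = g x) \<longrightarrow> u \<theta> f = u \<theta> g"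
        by (elim exE conjE) (rule that)
      obtain \<rho> S where \<rho>: "test \<rho>" "open S" "K \<subseteq> S" "\<And>x. x \<in> S \<Longrightarrow> \<rho> x = 1"
        using cutoff_on_compact[OF K(1)] by metis
      define \<psi> where "\<psi> x = xmono \<alpha> x * \<rho> x" for x
      have \<psi>: "test \<psi>" unfolding \<psi>_def by (intro test_mult smooth_xmono \<rho>)
      \<comment> \<open>The monomial is not a test function; replacing it by its cutoff turns the
        moment into a value of \<open>U\<close> on a tensor supported in
        \<open>t < 0\<close>.\<close>
      have "u \<theta> (xmono \<alpha>) = u \<theta> \<psi>"
        by (rule K(2)[rule_format, OF smooth_xmono test_smooth[OF \<psi>] \<rho>(2,3)]) (simp add: \<psi>_def \<rho>(4))
      also have "\<dots> = U (\<lambda>(x, t). \<theta> t * \<psi> x)" using agree[OF \<theta>(1) \<psi>] by simp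
      also have "\<dots> = 0"
        using neg test_tensor[OF \<theta>(1) \<psi>] \<theta>(2) unfolding vanishes_neg_def by fastforce
      finally show ?thesis .
    qed
    then show ?case
      using poly_op_annihilated_imp_zero[OF Lmap_clinear[OF u, of "xmono \<alpha>"] _ q ann] by blast
  qed
  then show ?thesis using \<phi> by blast
qed

section \<open>From tensor products to all test functions\<close>

lemma dmono_prod:
  fixes k :: "('a::euclidean_space \<times> 'b::euclidean_space) \<Rightarrow> nat"
  shows "dmono k (x, t) = dmono (\<lambda>b. k (b, 0)) x * dmono (\<lambda>b. k (0, b)) t"
proof -
  have "(\<lambda>b. (b, 0)) ` Basis \<inter> (\<lambda>b. (0, b)) ` Basis = ({} :: ('a \<times> 'b) set)" by auto
  moreover have "inj_on (\<lambda>b. (b, 0::'b)) (Basis :: 'a set)" "inj_on (\<lambda>b. (0::'a, b)) (Basis :: 'b set)"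
    by (auto intro: inj_onI)
  ultimately show ?thesis unfolding dmono_def Basis_prod_def
    by (subst prod.union_disjoint) (auto simp: prod.reindex)
qed

text \<open>Multiplying a polynomial \<open>P\<close> by a tensor cutoff \<open>G\<close> gives a
  sum of tensors of test functions, killed by \<open>U\<close>. Since \<open>G f = f\<close>, this
  leaves \<open>U f = U (G (f - P))\<close>, which is small.\<close>

lemma distribution_zero_if_tensors_zero:
  fixes U :: "(('a::euclidean_space \<times> real) \<Rightarrow> complex) \<Rightarrow> complex"
  assumes U: "distribution U" and f: "test f"
    and 0: "\<And>\<phi> \<psi>. test \<phi> \<Longrightarrow> test \<psi> \<Longrightarrow> U (\<lambda>(x, t). \<phi> t * \<psi> x) = 0"
  shows "U f = 0"
proof -
  have lin: "clinear_on test U" by (rule distribution_clinear[OF U])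
  have "compact (tsupp f)" using f by (simp add: test_def)
  then obtain r where r: "r > 0" "tsupp f \<subseteq> open_cube r" by (rule compact_subset_open_cube)
  obtain g1 :: "'a \<Rightarrow> complex" where g1: "test g1" "\<And>x. x \<in> cube r \<Longrightarrow> g1 x = 1" using cutoff_exists by metis
  obtain g2 :: "real \<Rightarrow> complex" where g2: "test g2" "\<And>x. x \<in> cube r \<Longrightarrow> g2 x = 1" using cutoff_exists by metis
  define G where "G = (\<lambda>(x, t). g2 t * g1 x)"
  have G: "test G" unfolding G_def by (rule test_tensor(1)[OF g2(1) g1(1)])
  have G1: "G z = 1" if "z \<in> open_cube r" for z
  proof -
    have "fst z \<in> cube r" "snd z \<in> cube r" 
      using that by (auto simp: open_cube_def cube_def Basis_prod_def ball_Un inner_prod_def less_imp_le)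
    then show ?thesis using g1(2) g2(2) by (simp add: G_def split_beta)
  qed
  have Gf: "G z * f z = f z" for z
  proof (cases "z \<in> tsupp f")
    case True
    then show ?thesis using G1[of z] r(2) by auto
  qed (simp add: not_in_tsupp)
  have GP: "U (\<lambda>z. G z * P z) = 0" if "P \<in> polys" for P
    using that
  proof induction
    case (dmono k)
    have eq: "(\<lambda>z. G z * dmono k z) = (\<lambda>(x, t). (dmono (\<lambda>b. k (0, b)) t * g2 t) * (dmono (\<lambda>b. k (b, 0)) x * g1 x))"
      by (auto simp: fun_eq_iff G_def dmono_prod)
    show ?case unfolding eq by (intro 0 test_mult smooth_dmono g1 g2)
  next
    case (add P Q)
    have "test (\<lambda>z. P z * G z)" "test (\<lambda>z. Q z * G z)" using add by (auto intro!: test_mult smooth_polys G)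
    then show ?case using clinear_on_add[OF lin, of "\<lambda>z. P z * G z" "\<lambda>z. Q z * G z"] add by (simp add: algebra_simps)
  next
    case (cmult P c)
    have "test (\<lambda>z. P z * G z)" using cmult by (auto intro!: test_mult smooth_polys G)
    then show ?case using clinear_on_cmult[OF lin, of "\<lambda>z. P z * G z" c] cmult by (simp add: algebra_simps)
  qed
  \<comment> \<open>The estimates live on the support of \<open>G\<close>, not of \<open>f\<close>:
    the polynomial \<open>P\<close> need not vanish where \<open>f\<close> does, so
    \<open>G (f - P)\<close> can fill it. Both constants are fixed before \<open>P\<close> is
    chosen.\<close>
  have cG: "compact (tsupp G)" using G by (simp add: test_def)
  from distribution_small_bound[OF U cG] obtain C N where C: "C \<ge> 0" and 
    "\<forall>f e. test f \<longrightarrow> tsupp f \<subseteq> tsupp G \<longrightarrow> 0 \<le> e \<longrightarrow> small N (tsupp G) e f \<longrightarrow> norm (U f) \<le> C * e"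
    by (elim exE conjE) (rule that)
  note bound = this(2)[rule_format]
  from small_mult[OF test_smooth[OF G] cG, of N] obtain C' where C': "C' \<ge> 0" and
    "\<forall>g e. smooth g \<longrightarrow> small N (tsupp G) e g \<longrightarrow> small N (tsupp G) (C' * e) (\<lambda>x. G x * g x)"
    by (elim exE conjE) (rule that)
  note mult = this(2)[rule_format]
  have *: "norm (U f) \<le> (C * C') * e" if e: "0 < e" for e
  proof -
    obtain P where P: "P \<in> polys" "small N (tsupp G) e (\<lambda>z. f z - P z)" by (rule polys_dense[OF f cG e])
    have sm: "smooth (\<lambda>z. f z - P z)" by (intro smooth_diff test_smooth f smooth_polys P)
    have t: "test (\<lambda>z. G z * (f z - P z))" using test_mult[OF sm G] by (simp add: mult.commute)
    have "tsupp (\<lambda>z. G z * (f z - P z)) \<subseteq> tsupp G" by (rule tsupp_subset[OF closed_tsupp]) (simp add: not_in_tsupp)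
    then have b: "norm (U (\<lambda>z. G z * (f z - P z))) \<le> C * (C' * e)"
      using e C' by (intro bound t mult sm P(2)) auto
    have "test (\<lambda>z. G z * P z)" using test_mult[OF smooth_polys[OF P(1)] G] by (simp add: mult.commute)
    from clinear_on_diff[OF lin f this] have "U (\<lambda>z. f z - G z * P z) = U f" using GP[OF P(1)] by simp
    moreover have "(\<lambda>z. f z - G z * P z) = (\<lambda>z. G z * (f z - P z))" by (simp add: Gf right_diff_distrib)
    ultimately show ?thesis using b by (simp add: mult.assoc)
  qed
  have "norm (U f) \<le> 0 + e" if "0 < e" for e 
    using *[of "e / (C * C')"] *[of 1] that C C' by (cases "C * C' = 0") auto
  then show ?thesis using field_le_epsilon[of "norm (U f)" 0] by auto
qed

lemma NS_nonzero_trivial: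
  fixes p :: "('d::finite option \<Rightarrow>\<^sub>0 nat) \<Rightarrow>\<^sub>0 complex"
  assumes p: "p \<noteq> 0" and N: "U \<in> NS LDE p"
  shows "U = (\<lambda>_. 0)"
proof
  fix f
  from N obtain u where U: "distribution U" and u: "Lmap u" 
    and agree: "\<And>\<phi> \<psi>. test \<phi> \<Longrightarrow> test \<psi> \<Longrightarrow> U (\<lambda>(x, t). \<phi> t * \<psi> x) = u \<phi> \<psi>"
    and D: "Dp p U = (\<lambda>_. 0)" and neg: "vanishes_neg U"
    unfolding NS_def LDE_def by blast
  show "U f = 0"
  proof (cases "test f")
    case True
    show ?thesis
    proof (rule distribution_zero_if_tensors_zero[OF U True])
      fix \<phi> :: "real \<Rightarrow> complex" and \<psi> assume \<phi>: "test \<phi>" and \<psi>: "test (\<psi> :: real^'d \<Rightarrow> complex)"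
      have "u \<phi> (dmono k) = 0" for k unfolding dmono_eq_xmono by (rule moment_zero[OF p U u agree D neg \<phi>])
      then have "u \<phi> \<psi> = 0" by (intro edist_zero_if_moments_zero[OF Lmap_edist[OF u \<phi>] _ \<psi>])
      then show "U (\<lambda>(x, t). \<phi> t * \<psi> x) = 0" using agree[OF \<phi> \<psi>] by simp
    qed
  next
    case False
    then show ?thesis using U unfolding distribution_def by blast
  qed
qed

section \<open>The zero element, and the point mass for \<open>p = 0\<close>\<close>

lemma zero_in_NS: "(\<lambda>_. 0) \<in> NS LDE p"
proof -
  have e: "edist (\<lambda>_. 0)" unfolding edist_def by (auto intro!: exI[of _ "{}"] exI[of _ "0::real"])
  have "Lmap (\<lambda>_ _. 0)" unfolding Lmap_def using e by (auto intro!: exI[of _ "0::real"])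
  moreover have "distribution (\<lambda>_. 0)" unfolding distribution_def by (auto intro!: exI[of _ "0::real"])
  ultimately show ?thesis unfolding NS_def LDE_def by (auto simp: Dp_def vanishes_neg_def)
qed

lemma bump_at:
  fixes x :: "'a::euclidean_space"
  obtains f where "test f" "f x = 1"
proof -
  have "compact {x}" by simp
  then show thesis using cutoff_on_compact[of "{x}"] that by (metis insert_subset)
qed

text \<open>The point mass corresponds to the map sending \<phi> to \<open>\<phi>(1)\<close> times
  the point mass at 0. All estimates have order 0; if the point of evaluation is outside
  \<open>K\<close>, functions supported in \<open>K\<close> vanish there.\<close>

lemma delta_in_LDE:
  "(\<lambda>f. if test f then f (0, 1) else 0) \<in> (LDE :: (((real^'d::finite) \<times> real \<Rightarrow> complex) \<Rightarrow> complex) set)"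
proof -
  define \<delta> where "\<delta> = (\<lambda>f. if test f then f (0::real^'d, 1::real) else (0::complex))"
  define u where "u = (\<lambda>\<phi> \<psi>. if test \<phi> \<and> smooth \<psi> then \<phi> (1::real) * \<psi> (0::real^'d) else (0::complex))"
  have pt: "norm (f x) \<le> sn 0 K f" if "smooth f" "compact K" "x \<in> K" 
    for f :: "'a::euclidean_space \<Rightarrow> complex" and K x
    using smallD[OF small_sn[OF that(1,2)], of "[]" 0 x] that(3) by simp
  have "distribution \<delta>"
    unfolding distribution_def
  proof (intro conjI allI impI)
    fix K :: "((real^'d) \<times> real) set" assume K: "compact K"
    show "\<exists>C N. \<forall>f. test f \<and> tsupp f \<subseteq> K \<longrightarrow> norm (\<delta> f) \<le> C * sn N K f"
    proof (cases "(0, 1) \<in> K")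
      case True
      then show ?thesis using pt[OF test_smooth K] by (intro exI[of _ 1] exI[of _ 0]) (auto simp: \<delta>_def)
    next
      case False
      then have "\<delta> f = 0" if "tsupp f \<subseteq> K" for f using that not_in_tsupp[of "(0, 1)" f] by (auto simp: \<delta>_def)
      then show ?thesis by (intro exI[of _ 0]) auto
    qed
  qed (auto simp: \<delta>_def test_lincomb)
  moreover have "Lmap u"
    unfolding Lmap_def
  proof (intro conjI allI impI)
    fix f :: "real \<Rightarrow> complex" assume f: "test f"
    show "edist (u f)"
      unfolding edist_def
    proof (intro conjI allI impI)
      have "norm (u f \<psi>) \<le> norm (f 1) * sn 0 {0} \<psi>" if "smooth \<psi>" for \<psi>
        using that pt[OF that, of "{0}" 0] sn_nonneg[OF that, of "{0}" 0] by (auto simp: u_def norm_mult intro!: mult_left_mono)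
      then show "\<exists>K C N. compact K \<and> (\<forall>\<psi>. smooth \<psi> \<longrightarrow> norm (u f \<psi>) \<le> C * sn N K \<psi>)"
        by (intro exI[of _ "{0}"] exI[of _ "norm (f 1)"] exI[of _ 0]) auto
    qed (auto simp: u_def smooth_add smooth_cmult algebra_simps)
  next
    fix f g :: "real \<Rightarrow> complex" and a b assume "test f" "test g"
    then show "u (\<lambda>x. a * f x + b * g x) = (\<lambda>\<psi>. a * u f \<psi> + b * u g \<psi>)"
      by (auto simp: u_def test_lincomb fun_eq_iff algebra_simps)
  next
    fix K :: "real set" and B :: "(real^'d \<Rightarrow> complex) set" assume K: "compact K" and B: "ebounded B"
    \<comment> \<open>Boundedness of \<open>B\<close> at the single seminorm \<open>sn 0 {0}\<close>
      bounds \<open>\<psi> 0\<close> uniformly over \<open>B\<close>, as the strong topology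
      demands.\<close>
    from B have "bdd_above (sn 0 {0} ` B)" unfolding ebounded_def by (auto dest: spec[of _ "{0}"])
    then obtain M where M: "\<And>\<psi>. \<psi> \<in> B \<Longrightarrow> sn 0 {0} \<psi> \<le> M" by (auto simp: bdd_above_def)
    have M': "norm (\<psi> 0) \<le> \<bar>M\<bar>" if "\<psi> \<in> B" for \<psi>
      using pt[of \<psi> "{0}" 0] M[OF that] B that by (force simp: ebounded_def)
    show "\<exists>C N. \<forall>f. test f \<and> tsupp f \<subseteq> K \<longrightarrow> (\<forall>\<psi>\<in>B. norm (u f \<psi>) \<le> C * sn N K f)"
    proof (cases "1 \<in> K")
      case True
      have "norm (u f \<psi>) \<le> \<bar>M\<bar> * sn 0 K f" if f: "test f" and \<psi>: "\<psi> \<in> B" for f \<psi>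
      proof -
        have "norm (u f \<psi>) \<le> norm (\<psi> 0) * norm (f 1)" by (auto simp: u_def norm_mult)
        also have "\<dots> \<le> \<bar>M\<bar> * sn 0 K f" by (intro mult_mono M' \<psi> pt test_smooth f K True) auto
        finally show ?thesis .
      qed
      then show ?thesis by (intro exI[of _ "\<bar>M\<bar>"] exI[of _ 0]) auto
    next
      case False
      then have "u f \<psi> = 0" if "tsupp f \<subseteq> K" for f \<psi> using that not_in_tsupp[of 1 f] by (auto simp: u_def)
      then show ?thesis by (intro exI[of _ 0]) auto
    qed
  qed
  moreover have "\<delta> (\<lambda>(x, t). \<phi> t * \<psi> x) = u \<phi> \<psi>" if "test \<phi>" "test \<psi>" for \<phi> \<psi>
    using that test_tensor(1)[OF that] by (simp add: \<delta>_def u_def test_smooth)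
  ultimately have "\<delta> \<in> LDE" unfolding LDE_def by auto
  then show ?thesis by (simp add: \<delta>_def)
qed

theorem theorem5p3:
  fixes p :: "('d::finite option \<Rightarrow>\<^sub>0 nat) \<Rightarrow>\<^sub>0 complex"
  shows "NS (LDE :: (((real^'d) \<times> real \<Rightarrow> complex) \<Rightarrow> complex) set) p = {\<lambda>_. 0} \<longleftrightarrow> p \<noteq> 0"
proof
  assume "p \<noteq> 0"
  then show "NS (LDE :: (((real^'d) \<times> real \<Rightarrow> complex) \<Rightarrow> complex) set) p = {\<lambda>_. 0}"
    using NS_nonzero_trivial zero_in_NS by blast
next
  assume N: "NS (LDE :: (((real^'d) \<times> real \<Rightarrow> complex) \<Rightarrow> complex) set) p = {\<lambda>_. 0}"
  show "p \<noteq> 0"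
  proof
    assume p: "p = 0"
    define \<delta> where "\<delta> = (\<lambda>f. if test f then f (0::real^'d, 1::real) else (0::complex))"
    \<comment> \<open>For \<open>p = 0\<close> the sum in \<open>dop_t\<close> is empty, so \<delta>
      is evaluated at the zero function.\<close>
    have "Dp p \<delta> = (\<lambda>_. 0)" by (auto simp: Dp_def dop_t_def p \<delta>_def)
    moreover have "vanishes_neg \<delta>"
      \<comment> \<open>The time coordinate 1 is positive, so a support in \<open>t < 0\<close>
        misses the point.\<close>
      unfolding vanishes_neg_def \<delta>_def using not_in_tsupp by fastforce
    ultimately have "\<delta> \<in> NS LDE p" using delta_in_LDE by (simp add: NS_def \<delta>_def)
    then have 0: "\<delta> = (\<lambda>_. 0)" using N by simp
    obtain f where "test f" "f (0::real^'d, 1::real) = 1" by (rule bump_at)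
    then have "\<delta> f = 1" by (simp add: \<delta>_def)
    then show False using 0 by simp
  qed
qed

end
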